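(* Let $(\Omega,\Sigma,\mu)$ be a measure space and let $Y$ be a real Banach space. If $Y$ is countably convexly generated (CCG), then $$\mathrm{NA}_\pi(L_1(\mu)\widehat{\otimes}_\pi Y)=L_1(\mu)\widehat{\otimes}_\pi Y.$$
   Context: All spaces are real. A real Banach space $Y$ is countably convexly generated (CCG) if there is a sequence $(e_n)_{n\in\mathbb N}\subseteq S_Y$ (the unit sphere) such that for each $y\in S_Y$ there is $(\lambda_n)_{n\in\mathbb N}\subseteq[0,+\infty)$ with $\sum_{n=1}^\infty\lambda_n=1$ and $y=\sum_{n=1}^\infty\lambda_ne_n$. $X\widehat{\otimes}_\pi Y$ denotes the projective tensor product; $L_1(\mu)\widehat{\otimes}_\pi Y$ is isometrically identified with the space $L_1(\mu,Y)$ of Bochner integrable functions. An element $u\in X\widehat{\otimes}_\pi Y$ attains its projective norm if there are $(x_i)\subseteq X$, $(y_i)\subseteq Y$ with $u=\sum_{i=1}^\infty x_i\otimes y_i$ and $\|u\|_\pi=\sum_{i=1}^\infty\|x_i\|\|y_i\|$; $\mathrm{NA}_\pi(X\widehat{\otimes}_\pi Y)$ is the set of such elements. *)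

theory Defs
  imports "HOL-Analysis.Analysis"
begin

section \<open>Normed spaces with explicit carriers\<close>

text \<open>The space $L_1(\mu)$ depends on the measure, hence it is not a type; real normed spaces are
  therefore represented by records. The axioms live in the locales below, and each construction is
  shown to satisfy them.\<close>

record 'v nspace =
  carrier :: "'v set"
  vadd :: "'v \<Rightarrow> 'v \<Rightarrow> 'v"
  vzero :: "'v"
  vscale :: "real \<Rightarrow> 'v \<Rightarrow> 'v"
  vnorm :: "'v \<Rightarrow> real"

definition vdist :: "'v nspace \<Rightarrow> 'v \<Rightarrow> 'v \<Rightarrow> real" where
  "vdist V x y = vnorm V (vadd V x (vscale V (-1) y))"

primrec vsum :: "'v nspace \<Rightarrow> (nat \<Rightarrow> 'v) \<Rightarrow> nat \<Rightarrow> 'v" where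
  "vsum V f 0 = vzero V"
| "vsum V f (Suc n) = vadd V (vsum V f n) (f n)"

definition vsums :: "'v nspace \<Rightarrow> (nat \<Rightarrow> 'v) \<Rightarrow> 'v \<Rightarrow> bool" where
  "vsums V f u \<longleftrightarrow> (\<lambda>n. vdist V (vsum V f n) u) \<longlonglongrightarrow> 0"

definition type_space :: "'b::real_normed_vector nspace" where
  "type_space = \<lparr>carrier = UNIV, vadd = (+), vzero = 0, vscale = scaleR, vnorm = norm\<rparr>"

locale seminormed_space =
  fixes V :: "'v nspace"
  assumes zero_closed: "vzero V \<in> carrier V"
    and add_closed: "x \<in> carrier V \<Longrightarrow> y \<in> carrier V \<Longrightarrow> vadd V x y \<in> carrier V"
    and scale_closed: "x \<in> carrier V \<Longrightarrow> vscale V c x \<in> carrier V"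
    and add_assoc: "x \<in> carrier V \<Longrightarrow> y \<in> carrier V \<Longrightarrow> z \<in> carrier V \<Longrightarrow>
      vadd V (vadd V x y) z = vadd V x (vadd V y z)"
    and add_commute: "x \<in> carrier V \<Longrightarrow> y \<in> carrier V \<Longrightarrow> vadd V x y = vadd V y x"
    and add_zero: "x \<in> carrier V \<Longrightarrow> vadd V x (vzero V) = x"
    and add_minus: "x \<in> carrier V \<Longrightarrow> vadd V x (vscale V (-1) x) = vzero V"
    and scale_one: "x \<in> carrier V \<Longrightarrow> vscale V 1 x = x"
    and scale_scale: "x \<in> carrier V \<Longrightarrow> vscale V c (vscale V d x) = vscale V (c * d) x"
    and scale_add_right: "x \<in> carrier V \<Longrightarrow> y \<in> carrier V \<Longrightarrow>
      vscale V c (vadd V x y) = vadd V (vscale V c x) (vscale V c y)"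
    and scale_add_left: "x \<in> carrier V \<Longrightarrow>
      vscale V (c + d) x = vadd V (vscale V c x) (vscale V d x)"
    and norm_scale: "x \<in> carrier V \<Longrightarrow> vnorm V (vscale V c x) = \<bar>c\<bar> * vnorm V x"
    and norm_triangle: "x \<in> carrier V \<Longrightarrow> y \<in> carrier V \<Longrightarrow>
      vnorm V (vadd V x y) \<le> vnorm V x + vnorm V y"

locale normed_space = seminormed_space +
  assumes norm_zeroD: "x \<in> carrier V \<Longrightarrow> vnorm V x = 0 \<Longrightarrow> x = vzero V"

lemma normed_space_type_space: "normed_space (type_space :: 'b::real_normed_vector nspace)"
  by unfold_locales (auto simp: type_space_def algebra_simps norm_triangle_ineq)


section \<open>The space $L_1(\mu)$\<close>

definition ae_rel :: "'a measure \<Rightarrow> (('a \<Rightarrow> real) \<times> ('a \<Rightarrow> real)) set" where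
  "ae_rel M = {(f, g). integrable M f \<and> integrable M g \<and> (AE x in M. f x = g x)}"

definition L1 :: "'a measure \<Rightarrow> ('a \<Rightarrow> real) set nspace" where
  "L1 M = \<lparr>carrier = {f. integrable M f} // ae_rel M,
     vadd = (\<lambda>F G. \<Union>f\<in>F. \<Union>g\<in>G. ae_rel M `` {\<lambda>x. f x + g x}),
     vzero = ae_rel M `` {\<lambda>x. 0},
     vscale = (\<lambda>c F. \<Union>f\<in>F. ae_rel M `` {\<lambda>x. c * f x}),
     vnorm = (\<lambda>F. the_elem ((\<lambda>f. \<integral>x. \<bar>f x\<bar> \<partial>M) ` F))\<rparr>"

lemma image_eq_singletonI: "x \<in> X \<Longrightarrow> (\<And>y. y \<in> X \<Longrightarrow> f y = c) \<Longrightarrow> f ` X = {c}"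
  by auto

lemma equiv_ae_rel: "equiv {f. integrable M f} (ae_rel M)"
  by (rule equivI) (auto simp: ae_rel_def refl_on_def sym_def trans_def)

lemma L1_class_self: "integrable M f \<Longrightarrow> f \<in> ae_rel M `` {f}"
  by (auto simp: ae_rel_def)

lemma L1_class_eqI:
  assumes "integrable M f" "integrable M g" "AE x in M. f x = g x"
  shows "ae_rel M `` {f} = ae_rel M `` {g}"
  using assms by (intro equiv_class_eq[OF equiv_ae_rel]) (auto simp: ae_rel_def)

lemma L1_add_class:
  assumes "integrable M f" "integrable M g"
  shows "vadd (L1 M) (ae_rel M `` {f}) (ae_rel M `` {g}) = ae_rel M `` {\<lambda>x. f x + g x}"
proof -
  have "ae_rel M `` {\<lambda>x. f' x + g' x} = ae_rel M `` {\<lambda>x. f x + g x}"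
    if "f' \<in> ae_rel M `` {f}" "g' \<in> ae_rel M `` {g}" for f' g'
    by (rule L1_class_eqI) (use that assms in \<open>auto simp: ae_rel_def\<close>)
  then show ?thesis
    unfolding L1_def nspace.simps
    by (intro UN_constant_eq[OF L1_class_self[OF assms(1)]]
        UN_constant_eq[OF L1_class_self[OF assms(2)]] ballI)
qed

lemma L1_scale_class:
  assumes "integrable M f"
  shows "vscale (L1 M) c (ae_rel M `` {f}) = ae_rel M `` {\<lambda>x. c * f x}"
proof -
  have "ae_rel M `` {\<lambda>x. c * f' x} = ae_rel M `` {\<lambda>x. c * f x}"
    if "f' \<in> ae_rel M `` {f}" for f'
  proof (rule L1_class_eqI)
    have "AE x in M. f x = f' x" using that by (simp add: ae_rel_def)
    then show "AE x in M. c * f' x = c * f x" by eventually_elim simp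
  qed (use that assms in \<open>auto simp: ae_rel_def\<close>)
  then show ?thesis
    unfolding L1_def nspace.simps
    by (intro UN_constant_eq[OF L1_class_self[OF assms]] ballI)
qed

lemma L1_norm_class:
  assumes "integrable M f"
  shows "vnorm (L1 M) (ae_rel M `` {f}) = (\<integral>x. \<bar>f x\<bar> \<partial>M)"
proof -
  have "(\<integral>x. \<bar>f' x\<bar> \<partial>M) = (\<integral>x. \<bar>f x\<bar> \<partial>M)" if "f' \<in> ae_rel M `` {f}" for f'
    by (rule integral_cong_AE) (use that assms in \<open>auto simp: ae_rel_def\<close>)
  then have "(\<lambda>f. \<integral>x. \<bar>f x\<bar> \<partial>M) ` (ae_rel M `` {f}) = {\<integral>x. \<bar>f x\<bar> \<partial>M}"
    by (intro image_eq_singletonI[OF L1_class_self[OF assms]])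
  then show ?thesis by (simp add: L1_def)
qed

lemma L1_zero: "vzero (L1 M) = ae_rel M `` {\<lambda>x. 0}"
  by (simp add: L1_def)

lemma L1_carrierE:
  assumes "F \<in> carrier (L1 M)"
  obtains f where "integrable M f" "F = ae_rel M `` {f}"
  using assms by (auto simp: L1_def elim!: quotientE)

lemma L1_carrierI: "integrable M f \<Longrightarrow> ae_rel M `` {f} \<in> carrier (L1 M)"
  by (auto simp: L1_def intro: quotientI)

lemma normed_space_L1: "normed_space (L1 M)"
proof
  fix x y assume "x \<in> carrier (L1 M)" "y \<in> carrier (L1 M)"
  then obtain f g where fg: "integrable M f" "x = ae_rel M `` {f}"
    "integrable M g" "y = ae_rel M `` {g}" by (metis L1_carrierE)
  have "(\<integral>x. \<bar>f x + g x\<bar> \<partial>M) \<le> (\<integral>x. \<bar>f x\<bar> + \<bar>g x\<bar> \<partial>M)"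
    using fg by (intro integral_mono) auto
  then show "vnorm (L1 M) (vadd (L1 M) x y) \<le> vnorm (L1 M) x + vnorm (L1 M) y"
    using fg by (simp add: L1_add_class L1_norm_class)
next
  fix x assume "x \<in> carrier (L1 M)" and 0: "vnorm (L1 M) x = 0"
  then obtain f where f: "integrable M f" "x = ae_rel M `` {f}" by (metis L1_carrierE)
  then have "AE x in M. f x = 0"
    using 0 integral_nonneg_eq_0_iff_AE[of M "\<lambda>x. \<bar>f x\<bar>"] by (simp add: L1_norm_class)
  then show "x = vzero (L1 M)"
    unfolding f(2) L1_zero by (intro L1_class_eqI f(1)) auto
qed ((elim L1_carrierE)?; simp add: L1_carrierI L1_add_class L1_scale_class L1_norm_class L1_zero
       algebra_simps abs_mult)+


section \<open>Completion of a (semi)normed space\<close>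

text \<open>Cauchy sequences modulo null sequences; for a merely seminormed space this also divides out
  the kernel of the seminorm.\<close>

definition cauchy_seqs :: "'v nspace \<Rightarrow> (nat \<Rightarrow> 'v) set" where
  "cauchy_seqs V = {s. (\<forall>n. s n \<in> carrier V) \<and>
     (\<forall>\<epsilon>>0. \<exists>N. \<forall>m\<ge>N. \<forall>n\<ge>N. vdist V (s m) (s n) < \<epsilon>)}"

definition null_rel :: "'v nspace \<Rightarrow> ((nat \<Rightarrow> 'v) \<times> (nat \<Rightarrow> 'v)) set" where
  "null_rel V = {(s, t). s \<in> cauchy_seqs V \<and> t \<in> cauchy_seqs V \<and>
     (\<lambda>n. vdist V (s n) (t n)) \<longlonglongrightarrow> 0}"

definition nspace_completion :: "'v nspace \<Rightarrow> (nat \<Rightarrow> 'v) set nspace" where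
  "nspace_completion V = \<lparr>carrier = cauchy_seqs V // null_rel V,
     vadd = (\<lambda>S T. \<Union>s\<in>S. \<Union>t\<in>T. null_rel V `` {\<lambda>n. vadd V (s n) (t n)}),
     vzero = null_rel V `` {\<lambda>n. vzero V},
     vscale = (\<lambda>c S. \<Union>s\<in>S. null_rel V `` {\<lambda>n. vscale V c (s n)}),
     vnorm = (\<lambda>S. the_elem ((\<lambda>s. lim (\<lambda>n. vnorm V (s n))) ` S))\<rparr>"

definition completion_embed :: "'v nspace \<Rightarrow> 'v \<Rightarrow> (nat \<Rightarrow> 'v) set" where
  "completion_embed V v = null_rel V `` {\<lambda>n. v}"

lemma null_comparison:
  fixes f g :: "nat \<Rightarrow> real"
  assumes "g \<longlonglongrightarrow> 0" "\<And>n. norm (f n) \<le> g n"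
  shows "f \<longlonglongrightarrow> 0"
  by (rule Lim_null_comparison[OF always_eventually]) (use assms in auto)

context seminormed_space
begin

lemma add_left_commute:
  assumes "x \<in> carrier V" "y \<in> carrier V" "z \<in> carrier V"
  shows "vadd V x (vadd V y z) = vadd V y (vadd V x z)"
  using assms by (metis add_assoc add_commute)

lemma norm_zero: "vnorm V (vzero V) = 0"
  using norm_scale[OF zero_closed, of 0] by (metis abs_zero add_minus mult_zero_left
    scale_add_left scale_one zero_closed add.right_inverse)

lemma norm_nonneg: "x \<in> carrier V \<Longrightarrow> 0 \<le> vnorm V x"
  using norm_triangle[of x "vscale V (-1) x"]
  by (simp add: add_minus norm_zero norm_scale scale_closed)

lemma minus_cancel:
  assumes "x \<in> carrier V" "y \<in> carrier V"
  shows "vadd V (vscale V (-1) x) (vadd V x y) = y"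
  using assms by (metis add_assoc add_commute add_minus add_zero scale_closed zero_closed)

lemma vdist_triangle:
  assumes "x \<in> carrier V" "y \<in> carrier V" "z \<in> carrier V"
  shows "vdist V x z \<le> vdist V x y + vdist V y z"
proof -
  have "vadd V x (vscale V (-1) z) =
      vadd V (vadd V x (vscale V (-1) y)) (vadd V y (vscale V (-1) z))"
    using assms by (simp add: add_assoc minus_cancel scale_closed add_closed)
  then show ?thesis
    unfolding vdist_def using assms by (simp add: norm_triangle scale_closed add_closed)
qed

lemma vdist_commute:
  assumes "x \<in> carrier V" "y \<in> carrier V"
  shows "vdist V x y = vdist V y x"
proof -
  have "vadd V x (vscale V (-1) y) = vscale V (-1) (vadd V y (vscale V (-1) x))"
    using assms by (simp add: scale_add_right scale_closed scale_scale scale_one add_commute)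
  then show ?thesis
    unfolding vdist_def using assms by (simp add: norm_scale scale_closed add_closed)
qed

lemma vdist_self: "x \<in> carrier V \<Longrightarrow> vdist V x x = 0"
  by (simp add: vdist_def add_minus norm_zero)

lemma vdist_nonneg: "x \<in> carrier V \<Longrightarrow> y \<in> carrier V \<Longrightarrow> 0 \<le> vdist V x y"
  by (simp add: vdist_def norm_nonneg scale_closed add_closed)

lemma vdist_add:
  assumes "x \<in> carrier V" "y \<in> carrier V" "x' \<in> carrier V" "y' \<in> carrier V"
  shows "vdist V (vadd V x y) (vadd V x' y') \<le> vdist V x x' + vdist V y y'"
proof -
  have "vadd V (vadd V x y) (vscale V (-1) (vadd V x' y')) =
      vadd V (vadd V x (vscale V (-1) x')) (vadd V y (vscale V (-1) y'))"
    using assms by (simp add: scale_add_right scale_closed add_closed add_assoc add_left_commute)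
  then show ?thesis
    unfolding vdist_def using assms by (simp add: norm_triangle scale_closed add_closed)
qed

lemma vdist_scale:
  assumes "x \<in> carrier V" "y \<in> carrier V"
  shows "vdist V (vscale V c x) (vscale V c y) = \<bar>c\<bar> * vdist V x y"
proof -
  have "vadd V (vscale V c x) (vscale V (-1) (vscale V c y)) =
      vscale V c (vadd V x (vscale V (-1) y))"
    using assms by (simp add: scale_add_right scale_closed scale_scale)
  then show ?thesis
    unfolding vdist_def using assms by (simp add: norm_scale scale_closed add_closed)
qed

lemma norm_diff_le_vdist:
  assumes "x \<in> carrier V" "y \<in> carrier V"
  shows "\<bar>vnorm V x - vnorm V y\<bar> \<le> vdist V x y"
proof -
  have *: "vnorm V x - vnorm V y \<le> vdist V x y"
    if "x \<in> carrier V" "y \<in> carrier V" for x y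
  proof -
    have "x = vadd V y (vadd V x (vscale V (-1) y))"
      using that by (metis add_commute add_left_commute minus_cancel add_closed scale_closed)
    then have "vnorm V x \<le> vnorm V y + vnorm V (vadd V x (vscale V (-1) y))"
      using that norm_triangle[of y "vadd V x (vscale V (-1) y)"]
      by (simp add: add_closed scale_closed)
    then show ?thesis by (simp add: vdist_def)
  qed
  show ?thesis
    using *[OF assms] *[OF assms(2,1)] vdist_commute[OF assms] by linarith
qed

lemma cauchy_seqs_add:
  assumes "s \<in> cauchy_seqs V" "t \<in> cauchy_seqs V"
  shows "(\<lambda>n. vadd V (s n) (t n)) \<in> cauchy_seqs V"
  unfolding cauchy_seqs_def
proof (intro CollectI conjI allI impI)
  fix e :: real assume "e > 0"
  then have "e/2 > 0" by simp
  then obtain N1 N2 where "\<forall>m\<ge>N1. \<forall>n\<ge>N1. vdist V (s m) (s n) < e/2"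
    "\<forall>m\<ge>N2. \<forall>n\<ge>N2. vdist V (t m) (t n) < e/2"
    using assms unfolding cauchy_seqs_def by blast
  moreover have "vdist V (vadd V (s m) (t m)) (vadd V (s n) (t n))
      \<le> vdist V (s m) (s n) + vdist V (t m) (t n)" for m n
    using assms by (intro vdist_add) (auto simp: cauchy_seqs_def)
  ultimately show "\<exists>N. \<forall>m\<ge>N. \<forall>n\<ge>N. vdist V (vadd V (s m) (t m)) (vadd V (s n) (t n)) < e"
    by (intro exI[of _ "max N1 N2"]) (smt (verit) field_sum_of_halves max.bounded_iff)
qed (use assms in \<open>auto simp: cauchy_seqs_def add_closed\<close>)

lemma cauchy_seqs_scale:
  assumes "s \<in> cauchy_seqs V"
  shows "(\<lambda>n. vscale V c (s n)) \<in> cauchy_seqs V"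
  unfolding cauchy_seqs_def
proof (intro CollectI conjI allI impI)
  have s: "s n \<in> carrier V" for n using assms by (auto simp: cauchy_seqs_def)
  fix e :: real assume "e > 0"
  then have "e / (\<bar>c\<bar> + 1) > 0" by simp
  then obtain N where N: "\<forall>m\<ge>N. \<forall>n\<ge>N. vdist V (s m) (s n) < e / (\<bar>c\<bar> + 1)"
    using assms unfolding cauchy_seqs_def by blast
  have "vdist V (vscale V c (s m)) (vscale V c (s n)) < e" if "m \<ge> N" "n \<ge> N" for m n
  proof -
    have "\<bar>c\<bar> * vdist V (s m) (s n) \<le> (\<bar>c\<bar> + 1) * vdist V (s m) (s n)"
      using vdist_nonneg[OF s s] by (intro mult_right_mono) auto
    also have "\<dots> < e"
      using N that by (simp add: pos_less_divide_eq mult.commute)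
    finally show ?thesis by (simp add: vdist_scale s)
  qed
  then show "\<exists>N. \<forall>m\<ge>N. \<forall>n\<ge>N. vdist V (vscale V c (s m)) (vscale V c (s n)) < e" by blast
qed (use assms in \<open>auto simp: cauchy_seqs_def scale_closed\<close>)

lemma cauchy_seqs_const: "x \<in> carrier V \<Longrightarrow> (\<lambda>n. x) \<in> cauchy_seqs V"
  by (auto simp: cauchy_seqs_def vdist_self)

lemma equiv_null_rel: "equiv (cauchy_seqs V) (null_rel V)"
proof (rule equivI)
  show "refl_on (cauchy_seqs V) (null_rel V)"
    by (auto simp: refl_on_def null_rel_def vdist_self cauchy_seqs_def)
  show "sym (null_rel V)"
  proof (rule symI)
    fix s t assume st: "(s, t) \<in> null_rel V"
    then have "vdist V (t n) (s n) = vdist V (s n) (t n)" for n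
      by (intro vdist_commute) (auto simp: null_rel_def cauchy_seqs_def)
    then show "(t, s) \<in> null_rel V" using st by (simp add: null_rel_def)
  qed
  show "trans (null_rel V)"
  proof (rule transI)
    fix s t u assume st: "(s, t) \<in> null_rel V" and tu: "(t, u) \<in> null_rel V"
    then have c: "s n \<in> carrier V" "t n \<in> carrier V" "u n \<in> carrier V" for n
      by (auto simp: null_rel_def cauchy_seqs_def)
    have "(\<lambda>n. vdist V (s n) (t n) + vdist V (t n) (u n)) \<longlonglongrightarrow> 0"
      using st tu by (intro tendsto_add_zero) (auto simp: null_rel_def)
    moreover have "norm (vdist V (s n) (u n)) \<le> vdist V (s n) (t n) + vdist V (t n) (u n)" for n
      using vdist_nonneg[of "s n" "u n"] vdist_triangle[of "s n" "t n" "u n"] c by simp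
    ultimately have "(\<lambda>n. vdist V (s n) (u n)) \<longlonglongrightarrow> 0"
      by (rule null_comparison)
    then show "(s, u) \<in> null_rel V" using st tu by (auto simp: null_rel_def)
  qed
qed (auto simp: null_rel_def)

lemma convergent_norm:
  assumes "s \<in> cauchy_seqs V"
  shows "convergent (\<lambda>n. vnorm V (s n))"
proof -
  have "\<bar>vnorm V (s m) - vnorm V (s n)\<bar> \<le> vdist V (s m) (s n)" for m n
    using assms by (intro norm_diff_le_vdist) (auto simp: cauchy_seqs_def)
  moreover have "\<exists>N. \<forall>m\<ge>N. \<forall>n\<ge>N. vdist V (s m) (s n) < e" if "e > 0" for e
    using assms that by (simp add: cauchy_seqs_def)
  ultimately have "Cauchy (\<lambda>n. vnorm V (s n))"
    unfolding Cauchy_def dist_real_def by (meson le_less_trans)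
  then show ?thesis by (simp add: Cauchy_convergent_iff)
qed

lemma completion_class_self: "s \<in> cauchy_seqs V \<Longrightarrow> s \<in> null_rel V `` {s}"
  by (rule equiv_class_self[OF equiv_null_rel])

lemma completion_class_eqI:
  assumes "s \<in> cauchy_seqs V" "t \<in> cauchy_seqs V" "(\<lambda>n. vdist V (s n) (t n)) \<longlonglongrightarrow> 0"
  shows "null_rel V `` {s} = null_rel V `` {t}"
  using assms by (intro equiv_class_eq[OF equiv_null_rel]) (auto simp: null_rel_def)

lemma completion_add_class:
  assumes "s \<in> cauchy_seqs V" "t \<in> cauchy_seqs V"
  shows "vadd (nspace_completion V) (null_rel V `` {s}) (null_rel V `` {t}) =
    null_rel V `` {\<lambda>n. vadd V (s n) (t n)}"
proof -
  have "null_rel V `` {\<lambda>n. vadd V (s' n) (t' n)} = null_rel V `` {\<lambda>n. vadd V (s n) (t n)}"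
    if st: "s' \<in> null_rel V `` {s}" "t' \<in> null_rel V `` {t}" for s' t'
  proof (rule completion_class_eqI)
    have c: "s n \<in> carrier V" "t n \<in> carrier V" "s' n \<in> carrier V" "t' n \<in> carrier V" for n
      using st by (auto simp: null_rel_def cauchy_seqs_def)
    have "(\<lambda>n. vdist V (s n) (s' n) + vdist V (t n) (t' n)) \<longlonglongrightarrow> 0"
      using st by (intro tendsto_add_zero) (auto simp: null_rel_def)
    moreover have "norm (vdist V (vadd V (s' n) (t' n)) (vadd V (s n) (t n)))
        \<le> vdist V (s n) (s' n) + vdist V (t n) (t' n)" for n
      using vdist_nonneg[of "vadd V (s' n) (t' n)" "vadd V (s n) (t n)"]
        vdist_add[of "s' n" "t' n" "s n" "t n"] vdist_commute[of "s n" "s' n"]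
        vdist_commute[of "t n" "t' n"] c by (simp add: add_closed)
    ultimately show "(\<lambda>n. vdist V (vadd V (s' n) (t' n)) (vadd V (s n) (t n))) \<longlonglongrightarrow> 0"
      by (rule null_comparison)
  qed (use that assms in \<open>auto simp: null_rel_def intro!: cauchy_seqs_add\<close>)
  then show ?thesis
    unfolding nspace_completion_def nspace.simps
    by (intro UN_constant_eq[OF completion_class_self[OF assms(1)]]
        UN_constant_eq[OF completion_class_self[OF assms(2)]] ballI)
qed

lemma completion_scale_class:
  assumes "s \<in> cauchy_seqs V"
  shows "vscale (nspace_completion V) c (null_rel V `` {s}) = null_rel V `` {\<lambda>n. vscale V c (s n)}"
proof -
  have "null_rel V `` {\<lambda>n. vscale V c (s' n)} = null_rel V `` {\<lambda>n. vscale V c (s n)}"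
    if st: "s' \<in> null_rel V `` {s}" for s'
  proof (rule completion_class_eqI)
    have c: "s n \<in> carrier V" "s' n \<in> carrier V" for n
      using st by (auto simp: null_rel_def cauchy_seqs_def)
    have "(\<lambda>n. \<bar>c\<bar> * vdist V (s n) (s' n)) \<longlonglongrightarrow> \<bar>c\<bar> * 0"
      using st by (intro tendsto_mult tendsto_const) (auto simp: null_rel_def)
    then show "(\<lambda>n. vdist V (vscale V c (s' n)) (vscale V c (s n))) \<longlonglongrightarrow> 0"
      using vdist_commute[OF c] by (simp add: vdist_scale c)
  qed (use that assms in \<open>auto simp: null_rel_def intro!: cauchy_seqs_scale\<close>)
  then show ?thesis
    unfolding nspace_completion_def nspace.simps
    by (intro UN_constant_eq[OF completion_class_self[OF assms]] ballI)
qed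

lemma completion_norm_class:
  assumes "s \<in> cauchy_seqs V"
  shows "(\<lambda>n. vnorm V (s n)) \<longlonglongrightarrow> vnorm (nspace_completion V) (null_rel V `` {s})"
proof -
  let ?L = "lim (\<lambda>n. vnorm V (s n))"
  have L: "(\<lambda>n. vnorm V (s n)) \<longlonglongrightarrow> ?L"
    using convergent_norm[OF assms] by (simp add: convergent_LIMSEQ_iff)
  have "lim (\<lambda>n. vnorm V (s' n)) = ?L" if st: "s' \<in> null_rel V `` {s}" for s'
  proof -
    have c: "s n \<in> carrier V" "s' n \<in> carrier V" for n
      using st by (auto simp: null_rel_def cauchy_seqs_def)
    have "(\<lambda>n. vdist V (s n) (s' n)) \<longlonglongrightarrow> 0"
      using st by (auto simp: null_rel_def)
    then have "(\<lambda>n. vnorm V (s n) - vnorm V (s' n)) \<longlonglongrightarrow> 0"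
      by (rule null_comparison) (simp add: norm_diff_le_vdist c)
    from tendsto_diff[OF L this] show ?thesis by (auto intro: limI)
  qed
  then have "(\<lambda>s. lim (\<lambda>n. vnorm V (s n))) ` (null_rel V `` {s}) = {?L}"
    by (intro image_eq_singletonI[OF completion_class_self[OF assms]])
  then show ?thesis using L by (simp add: nspace_completion_def)
qed

lemma completion_carrierE:
  assumes "S \<in> carrier (nspace_completion V)"
  obtains s where "s \<in> cauchy_seqs V" "S = null_rel V `` {s}"
  using assms by (auto simp: nspace_completion_def elim!: quotientE)

lemma completion_carrierI: "s \<in> cauchy_seqs V \<Longrightarrow> null_rel V `` {s} \<in> carrier (nspace_completion V)"
  by (auto simp: nspace_completion_def intro: quotientI)

lemma completion_zero: "vzero (nspace_completion V) = null_rel V `` {\<lambda>n. vzero V}"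
  by (simp add: nspace_completion_def)

lemma normed_space_completion: "normed_space (nspace_completion V)"
proof
  fix S c assume "S \<in> carrier (nspace_completion V)"
  then obtain s where s: "s \<in> cauchy_seqs V" "S = null_rel V `` {s}"
    by (rule completion_carrierE)
  have "(\<lambda>n. vnorm V (vscale V c (s n))) \<longlonglongrightarrow> vnorm (nspace_completion V) (vscale (nspace_completion V) c S)"
    using completion_norm_class[OF cauchy_seqs_scale[OF s(1)]] s
    by (simp add: completion_scale_class)
  moreover have "(\<lambda>n. vnorm V (vscale V c (s n))) \<longlonglongrightarrow> \<bar>c\<bar> * vnorm (nspace_completion V) S"
    using tendsto_mult[OF tendsto_const completion_norm_class[OF s(1)], of "\<bar>c\<bar>"] s
    by (simp add: norm_scale cauchy_seqs_def)
  ultimately show "vnorm (nspace_completion V) (vscale (nspace_completion V) c S) = \<bar>c\<bar> * vnorm (nspace_completion V) S"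
    by (rule LIMSEQ_unique)
next
  fix S T assume "S \<in> carrier (nspace_completion V)" "T \<in> carrier (nspace_completion V)"
  then obtain s t where st: "s \<in> cauchy_seqs V" "S = null_rel V `` {s}"
    "t \<in> cauchy_seqs V" "T = null_rel V `` {t}"
    by (metis completion_carrierE)
  have 1: "(\<lambda>n. vnorm V (vadd V (s n) (t n))) \<longlonglongrightarrow> vnorm (nspace_completion V) (vadd (nspace_completion V) S T)"
    using completion_norm_class[OF cauchy_seqs_add[OF st(1,3)]] st
    by (simp add: completion_add_class)
  show "vnorm (nspace_completion V) (vadd (nspace_completion V) S T)
      \<le> vnorm (nspace_completion V) S + vnorm (nspace_completion V) T"
    using st by (intro LIMSEQ_le[OF 1 tendsto_add[OF completion_norm_class[OF st(1)]
        completion_norm_class[OF st(3)], folded st(2,4)]]) (auto simp: cauchy_seqs_def norm_triangle)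
next
  fix S assume "S \<in> carrier (nspace_completion V)" and 0: "vnorm (nspace_completion V) S = 0"
  then obtain s where s: "s \<in> cauchy_seqs V" "S = null_rel V `` {s}"
    by (metis completion_carrierE)
  have c: "s n \<in> carrier V" for n using s by (auto simp: cauchy_seqs_def)
  have "vscale V (-1) (vzero V) = vzero V"
    by (metis add_minus add_commute add_zero scale_closed zero_closed)
  then have "vdist V (s n) (vzero V) = vnorm V (s n)" for n
    by (simp add: vdist_def add_zero c)
  then show "S = vzero (nspace_completion V)"
    using completion_norm_class[OF s(1)] 0 s(2) unfolding completion_zero s(2)
    by (intro completion_class_eqI cauchy_seqs_const zero_closed s(1)) simp
qed ((elim completion_carrierE)?;
     simp add: completion_carrierI completion_add_class completion_scale_class completion_zero
       cauchy_seqs_add cauchy_seqs_scale cauchy_seqs_const zero_closed;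
     simp add: cauchy_seqs_def add_assoc add_commute add_zero add_minus scale_one scale_scale
       scale_add_right scale_add_left)+

end



section \<open>The projective tensor product\<close>

text \<open>As usual, the elementary tensor $x \otimes y$ is the functional $A \mapsto A(x, y)$ on the
  space of all bilinear forms $A$ on $X \times Y$, and $X \otimes Y$ is the linear span of the
  elementary tensors, that is, the set of their finite sums.\<close>

definition bilinear_forms :: "'x nspace \<Rightarrow> 'y nspace \<Rightarrow> ('x \<Rightarrow> 'y \<Rightarrow> real) set" where
  "bilinear_forms X Y = {A.
     (\<forall>x\<in>carrier X. \<forall>x'\<in>carrier X. \<forall>y\<in>carrier Y. A (vadd X x x') y = A x y + A x' y) \<and>
     (\<forall>c. \<forall>x\<in>carrier X. \<forall>y\<in>carrier Y. A (vscale X c x) y = c * A x y) \<and>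
     (\<forall>x\<in>carrier X. \<forall>y\<in>carrier Y. \<forall>y'\<in>carrier Y. A x (vadd Y y y') = A x y + A x y') \<and>
     (\<forall>c. \<forall>x\<in>carrier X. \<forall>y\<in>carrier Y. A x (vscale Y c y) = c * A x y)}"

type_synonym ('x, 'y) tensor = "('x \<Rightarrow> 'y \<Rightarrow> real) \<Rightarrow> real"

definition tensor :: "'x nspace \<Rightarrow> 'y nspace \<Rightarrow> 'x \<Rightarrow> 'y \<Rightarrow> ('x, 'y) tensor" where
  "tensor X Y x y = (\<lambda>A\<in>bilinear_forms X Y. A x y)"

definition tensor_sum ::
  "'x nspace \<Rightarrow> 'y nspace \<Rightarrow> nat \<Rightarrow> (nat \<Rightarrow> 'x) \<Rightarrow> (nat \<Rightarrow> 'y) \<Rightarrow> ('x, 'y) tensor" where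
  "tensor_sum X Y n x y = (\<lambda>A\<in>bilinear_forms X Y. \<Sum>i<n. tensor X Y (x i) (y i) A)"

definition rep_costs :: "'x nspace \<Rightarrow> 'y nspace \<Rightarrow> ('x, 'y) tensor \<Rightarrow> real set" where
  "rep_costs X Y u = {\<Sum>i<n. vnorm X (x i) * vnorm Y (y i) | n x y.
     (\<forall>i<n. x i \<in> carrier X \<and> y i \<in> carrier Y) \<and> u = tensor_sum X Y n x y}"

definition projective_norm :: "'x nspace \<Rightarrow> 'y nspace \<Rightarrow> ('x, 'y) tensor \<Rightarrow> real" where
  "projective_norm X Y u = Inf (rep_costs X Y u)"

definition algebraic_tensor_product ::
  "'x nspace \<Rightarrow> 'y nspace \<Rightarrow> ('x, 'y) tensor nspace" where
  "algebraic_tensor_product X Y =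
    \<lparr>carrier = {tensor_sum X Y n x y | n x y. \<forall>i<n. x i \<in> carrier X \<and> y i \<in> carrier Y},
     vadd = (\<lambda>u v. \<lambda>A\<in>bilinear_forms X Y. u A + v A),
     vzero = (\<lambda>A\<in>bilinear_forms X Y. 0),
     vscale = (\<lambda>c u. \<lambda>A\<in>bilinear_forms X Y. c * u A),
     vnorm = projective_norm X Y\<rparr>"

lemma tensor_sum_eq: "tensor_sum X Y n x y = (\<lambda>A\<in>bilinear_forms X Y. \<Sum>i<n. A (x i) (y i))"
  by (auto simp: tensor_sum_def tensor_def)

lemma rep_costsI:
  assumes "\<forall>i<n. x i \<in> carrier X \<and> y i \<in> carrier Y"
  shows "(\<Sum>i<n. vnorm X (x i) * vnorm Y (y i)) \<in> rep_costs X Y (tensor_sum X Y n x y)"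
  unfolding rep_costs_def using assms by blast

lemma tensor_sum_append:
  assumes "\<forall>i<n. x i \<in> carrier X \<and> y i \<in> carrier Y" "\<forall>i<m. x' i \<in> carrier X \<and> y' i \<in> carrier Y"
  shows "\<exists>x'' y''. (\<forall>i<n+m. x'' i \<in> carrier X \<and> y'' i \<in> carrier Y) \<and>
    tensor_sum X Y (n + m) x'' y'' =
      (\<lambda>A\<in>bilinear_forms X Y. tensor_sum X Y n x y A + tensor_sum X Y m x' y' A) \<and>
    (\<Sum>i<n+m. vnorm X (x'' i) * vnorm Y (y'' i)) =
      (\<Sum>i<n. vnorm X (x i) * vnorm Y (y i)) + (\<Sum>i<m. vnorm X (x' i) * vnorm Y (y' i))"
proof -
  define x'' where "x'' i = (if i < n then x i else x' (i - n))" for i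
  define y'' where "y'' i = (if i < n then y i else y' (i - n))" for i
  have split: "(\<Sum>i<n+m. h i) = (\<Sum>i<n. h i) + (\<Sum>i<m. h (n + i))" for h :: "nat \<Rightarrow> real"
    by (induction m) (auto simp: add.assoc)
  have "(\<forall>i<n+m. x'' i \<in> carrier X \<and> y'' i \<in> carrier Y)"
    using assms by (auto simp: x''_def y''_def)
  moreover have "(\<Sum>i<n+m. g (x'' i) (y'' i)) = (\<Sum>i<n. g (x i) (y i)) + (\<Sum>i<m. g (x' i) (y' i))"
    for g :: "_ \<Rightarrow> _ \<Rightarrow> real"
    unfolding split by (simp add: x''_def y''_def)
  note this[of "\<lambda>a b. vnorm X a * vnorm Y b"] this
  ultimately show ?thesis
    by (intro exI[of _ x''] exI[of _ y'']) (auto simp: tensor_sum_eq restrict_def fun_eq_iff)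
qed

lemma (in seminormed_space) bilinear_tensor_sum_scale:
  assumes "\<forall>i<n. x i \<in> carrier V \<and> y i \<in> carrier Y"
  shows "tensor_sum V Y n (\<lambda>i. vscale V c (x i)) y =
    (\<lambda>A\<in>bilinear_forms V Y. c * tensor_sum V Y n x y A)"
  using assms
  by (auto simp: tensor_sum_eq restrict_def fun_eq_iff bilinear_forms_def sum_distrib_left)

context
  fixes X :: "'x nspace" and Y :: "'y nspace"
  assumes X: "seminormed_space X" and Y: "seminormed_space Y"
begin

private abbreviation "T \<equiv> algebraic_tensor_product X Y"

lemma rep_costs_nonneg: "a \<in> rep_costs X Y u \<Longrightarrow> 0 \<le> a"
  by (auto simp: rep_costs_def intro!: sum_nonneg mult_nonneg_nonneg
      seminormed_space.norm_nonneg[OF X] seminormed_space.norm_nonneg[OF Y])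

lemma bdd_below_rep_costs: "bdd_below (rep_costs X Y u)"
  using rep_costs_nonneg by (rule bdd_belowI)

lemma rep_costs_nonempty: "u \<in> carrier T \<Longrightarrow> rep_costs X Y u \<noteq> {}"
  unfolding rep_costs_def algebraic_tensor_product_def nspace.simps by blast

lemma projective_norm_le: "a \<in> rep_costs X Y u \<Longrightarrow> projective_norm X Y u \<le> a"
  unfolding projective_norm_def
  by (rule cInf_lower[OF _ bdd_below_rep_costs])

lemma projective_norm_ge:
  assumes "u \<in> carrier T" "\<And>a. a \<in> rep_costs X Y u \<Longrightarrow> b \<le> a"
  shows "b \<le> projective_norm X Y u"
  unfolding projective_norm_def
  using assms by (intro cInf_greatest rep_costs_nonempty)

lemma rep_costs_add:
  assumes "a \<in> rep_costs X Y u" "b \<in> rep_costs X Y v"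
  shows "a + b \<in> rep_costs X Y (vadd T u v)"
proof -
  obtain n x y m x' y' where
    1: "\<forall>i<n. x i \<in> carrier X \<and> y i \<in> carrier Y" "\<forall>i<m. x' i \<in> carrier X \<and> y' i \<in> carrier Y"
    and 2: "u = tensor_sum X Y n x y" "a = (\<Sum>i<n. vnorm X (x i) * vnorm Y (y i))"
      "v = tensor_sum X Y m x' y'" "b = (\<Sum>i<m. vnorm X (x' i) * vnorm Y (y' i))"
    using assms unfolding rep_costs_def by blast
  obtain x'' y'' where 3: "\<forall>i<n+m. x'' i \<in> carrier X \<and> y'' i \<in> carrier Y"
    and 4: "tensor_sum X Y (n + m) x'' y'' = vadd T u v"
      "(\<Sum>i<n+m. vnorm X (x'' i) * vnorm Y (y'' i)) = a + b"
    using tensor_sum_append[OF 1] unfolding algebraic_tensor_product_def nspace.simps 2 by blast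
  show ?thesis
    using rep_costsI[of "n + m" x'' X y'' Y, OF 3] unfolding 4 .
qed

lemma rep_costs_scale:
  assumes "a \<in> rep_costs X Y u"
  shows "\<bar>c\<bar> * a \<in> rep_costs X Y (vscale T c u)"
proof -
  obtain n x y where 1: "\<forall>i<n. x i \<in> carrier X \<and> y i \<in> carrier Y"
    and 2: "u = tensor_sum X Y n x y" "a = (\<Sum>i<n. vnorm X (x i) * vnorm Y (y i))"
    using assms unfolding rep_costs_def by blast
  have 3: "vscale T c u = tensor_sum X Y n (\<lambda>i. vscale X c (x i)) y"
    unfolding 2 seminormed_space.bilinear_tensor_sum_scale[OF X 1]
    by (simp add: algebraic_tensor_product_def)
  have 4: "\<bar>c\<bar> * a = (\<Sum>i<n. vnorm X (vscale X c (x i)) * vnorm Y (y i))"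
    unfolding 2 sum_distrib_left
    using 1 by (intro sum.cong) (simp_all add: seminormed_space.norm_scale[OF X])
  have "\<forall>i<n. vscale X c (x i) \<in> carrier X \<and> y i \<in> carrier Y"
    using 1 by (simp add: seminormed_space.scale_closed[OF X])
  then show ?thesis
    unfolding 3 4 by (rule rep_costsI)
qed

lemma rep_costs_carrier: "a \<in> rep_costs X Y u \<Longrightarrow> u \<in> carrier T"
  by (auto simp: rep_costs_def algebraic_tensor_product_def)

lemma algebraic_tensor_add_closed:
  "u \<in> carrier T \<Longrightarrow> v \<in> carrier T \<Longrightarrow> vadd T u v \<in> carrier T"
  by (meson rep_costs_add rep_costs_carrier rep_costs_nonempty ex_in_conv)

lemma algebraic_tensor_scale_closed: "u \<in> carrier T \<Longrightarrow> vscale T c u \<in> carrier T"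
  by (meson rep_costs_scale rep_costs_carrier rep_costs_nonempty ex_in_conv)

lemma rep_costs_zero: "0 \<in> rep_costs X Y (vzero T)"
  unfolding rep_costs_def
  by (intro CollectI exI[of _ "0::nat"])
     (simp add: tensor_sum_def algebraic_tensor_product_def)

lemma algebraic_tensor_undefined:
  "u \<in> carrier T \<Longrightarrow> A \<notin> bilinear_forms X Y \<Longrightarrow> u A = undefined"
  by (auto simp: algebraic_tensor_product_def tensor_sum_def)

lemma vnorm_algebraic_tensor: "vnorm T u = projective_norm X Y u"
  by (simp add: algebraic_tensor_product_def)

lemma projective_norm_scale_le:
  assumes u: "u \<in> carrier T"
  shows "projective_norm X Y (vscale T c u) \<le> \<bar>c\<bar> * projective_norm X Y u"
proof (cases "c = 0")
  case True
  have "vscale T c u = vzero T" by (simp add: True algebraic_tensor_product_def)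
  then show ?thesis using True projective_norm_le[OF rep_costs_zero] by simp
next
  case False
  have "projective_norm X Y (vscale T c u) / \<bar>c\<bar> \<le> a" if "a \<in> rep_costs X Y u" for a
    using projective_norm_le[OF rep_costs_scale[OF that, of c]] False
    by (simp add: pos_divide_le_eq mult.commute)
  from projective_norm_ge[OF u this] show ?thesis
    using False by (simp add: pos_divide_le_eq mult.commute)
qed

lemma seminormed_space_algebraic_tensor_product: "seminormed_space T"
proof
  show "vzero T \<in> carrier T" by (rule rep_costs_carrier[OF rep_costs_zero])
next
  fix u c assume u: "u \<in> carrier T"
  show "vscale T 1 u = u" and "vadd T u (vzero T) = u"
    using algebraic_tensor_undefined[OF u]
    by (auto simp: algebraic_tensor_product_def restrict_def fun_eq_iff)
  show "vnorm T (vscale T c u) = \<bar>c\<bar> * vnorm T u"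
  proof (cases "c = 0")
    case True
    then have "vscale T c u = vzero T" by (simp add: algebraic_tensor_product_def)
    moreover have "projective_norm X Y (vzero T) = 0"
      using projective_norm_le[OF rep_costs_zero]
        projective_norm_ge[OF rep_costs_carrier[OF rep_costs_zero] rep_costs_nonneg] by force
    ultimately show ?thesis using True by (simp add: vnorm_algebraic_tensor)
  next
    case False
    have "vscale T (1 / c) (vscale T c u) = u"
      using False algebraic_tensor_undefined[OF u]
      by (auto simp: algebraic_tensor_product_def restrict_def fun_eq_iff)
    then have "projective_norm X Y u \<le> \<bar>1 / c\<bar> * projective_norm X Y (vscale T c u)"
      using projective_norm_scale_le[OF algebraic_tensor_scale_closed[OF u, of c], of "1 / c"]
      by simp
    then have "\<bar>c\<bar> * projective_norm X Y u \<le> projective_norm X Y (vscale T c u)"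
      using False by (simp add: field_simps)
    then show ?thesis
      using projective_norm_scale_le[OF u, of c] by (simp add: vnorm_algebraic_tensor)
  qed
next
  fix u v assume uv: "u \<in> carrier T" "v \<in> carrier T"
  have "projective_norm X Y (vadd T u v) - projective_norm X Y u \<le> b"
    if b: "b \<in> rep_costs X Y v" for b
  proof -
    have "projective_norm X Y (vadd T u v) - b \<le> a" if a: "a \<in> rep_costs X Y u" for a
      using projective_norm_le[OF rep_costs_add[OF a b]] by simp
    from projective_norm_ge[OF uv(1) this] show ?thesis by simp
  qed
  from projective_norm_ge[OF uv(2) this]
  show "vnorm T (vadd T u v) \<le> vnorm T u + vnorm T v"
    by (simp add: vnorm_algebraic_tensor)
qed (simp_all add: algebraic_tensor_add_closed algebraic_tensor_scale_closed,
     simp_all add: algebraic_tensor_product_def restrict_def fun_eq_iff algebra_simps)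

end

definition projective_tensor_product ::
  "'x nspace \<Rightarrow> 'y nspace \<Rightarrow> (nat \<Rightarrow> ('x, 'y) tensor) set nspace" where
  "projective_tensor_product X Y = nspace_completion (algebraic_tensor_product X Y)"

lemma normed_space_projective_tensor_product:
  "seminormed_space X \<Longrightarrow> seminormed_space Y \<Longrightarrow> normed_space (projective_tensor_product X Y)"
  unfolding projective_tensor_product_def
  by (intro seminormed_space.normed_space_completion seminormed_space_algebraic_tensor_product)

definition proj_tensor ::
  "'x nspace \<Rightarrow> 'y nspace \<Rightarrow> 'x \<Rightarrow> 'y \<Rightarrow> (nat \<Rightarrow> ('x, 'y) tensor) set" where
  "proj_tensor X Y x y = completion_embed (algebraic_tensor_product X Y) (tensor X Y x y)"

definition attains_projective_norm ::
  "'x nspace \<Rightarrow> 'y nspace \<Rightarrow> (nat \<Rightarrow> ('x, 'y) tensor) set \<Rightarrow> bool" where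
  "attains_projective_norm X Y u \<longleftrightarrow>
    (\<exists>x y. (\<forall>i. x i \<in> carrier X) \<and> (\<forall>i. y i \<in> carrier Y) \<and>
       vsums (projective_tensor_product X Y) (\<lambda>i. proj_tensor X Y (x i) (y i)) u \<and>
       (\<lambda>i. vnorm X (x i) * vnorm Y (y i)) sums vnorm (projective_tensor_product X Y) u)"

definition NA_pi :: "'x nspace \<Rightarrow> 'y nspace \<Rightarrow> (nat \<Rightarrow> ('x, 'y) tensor) set set" where
  "NA_pi X Y = {u \<in> carrier (projective_tensor_product X Y). attains_projective_norm X Y u}"


section \<open>Countably convexly generated spaces\<close>

definition CCG :: "'b::banach itself \<Rightarrow> bool" where
  "CCG _ \<longleftrightarrow> (\<exists>e :: nat \<Rightarrow> 'b. range e \<subseteq> sphere 0 1 \<and>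
     (\<forall>y \<in> sphere 0 1. \<exists>l :: nat \<Rightarrow> real.
        (\<forall>n. 0 \<le> l n) \<and> l sums 1 \<and> (\<lambda>n. l n *\<^sub>R e n) sums y))"

end

theory Submission
  imports Defs
begin

text \<open>An element $u$ of the tensor product is given by a strongly measurable function
  $f : \Omega \to Y$ with $\|u\| = \int \|f\|$. If measurable $x_n \ge 0$ satisfy
  $f(\omega) = \sum_n x_n(\omega) e_n$ and $\|f(\omega)\| = \sum_n x_n(\omega)$, then
  $u = \sum_n x_n \otimes e_n$ attains the norm. CCG gives such coefficients for each $\omega$
  separately; to choose them measurably, prescribe a rate of convergence of the series. Continuity
  from below of outer measures yields a rate that is possible for all $\omega$ outside a set of small
  measure, and the coefficient sequences with a fixed rate form a compact set depending on
  $f(\omega)$ in a closed way, so that their lexicographic minimum is measurable.\<close>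

text \<open>The generating coefficients of one vector lie in a compact box of real sequences, but
  coordinatewise limits may lose mass at infinity, so they need not form a closed set. A rate
  replaces convergence by conditions on finitely many coordinates each, and these survive such
  limits. The points at which a given rate is possible are described by a quantifier over
  uncountably many sequences, so their measurability is not visible at first; outer measures bridge
  this gap until the rate is fixed, and compactness then reduces the quantifier to countably many
  rational grid points. An arbitrary measure is handled through the finite measure with density
  \<open>norm (f w)\<close>, which loses only the points where \<open>f\<close> vanishes, and there
  zero coefficients serve. Finally, the distance from a partial sum to \<open>f w\<close> is at most
  \<open>norm (f w)\<close> minus the coefficients used so far, so a single real series shows both
  that the tensors converge to $u$ and that their costs add up to its norm.\<close>

section \<open>Compactness in the coordinatewise topology\<close>

lemma compact_Int_decseq_nonempty:
  fixes F :: "nat \<Rightarrow> 'x::topological_space set"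
  assumes "compact S" "\<And>n. closed (F n)" "decseq F" "\<And>n. S \<inter> F n \<noteq> {}"
  shows "S \<inter> (\<Inter>n. F n) \<noteq> {}"
proof (rule compact_imp_fip_image[OF assms(1)])
  fix I :: "nat set" assume "finite I"
  then obtain m where "\<forall>i\<in>I. i \<le> m"
    using finite_nat_set_iff_bounded_le by blast
  then have "F m \<subseteq> (\<Inter>i\<in>I. F i)"
    using assms(3) by (auto simp: decseq_def)
  then show "S \<inter> (\<Inter>i\<in>I. F i) \<noteq> {}"
    using assms(4)[of m] by blast
qed (rule assms(2))

text \<open>Tychonoff's theorem, transferred to the type class topology on functions.\<close>

lemma compact_box: "compact (PiE UNIV (\<lambda>i::'i. {a..b::real}))"
proof -
  have "compactin (product_topology (\<lambda>i::'i. euclidean) UNIV) (PiE UNIV (\<lambda>i. {a..b::real}))"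
    by (subst compactin_PiE) auto
  then show ?thesis by (simp add: euclidean_product_topology)
qed

section \<open>Lexicographically minimal selections\<close>

text \<open>Coordinates are minimized one after another, each over the members of \<open>K\<close>
  that attain all earlier minima. The range \<open>{..<n}\<close> in the quantifier is what makes
  the recursion descend.\<close>

fun lexmin :: "(nat \<Rightarrow> real) set \<Rightarrow> nat \<Rightarrow> real" where
  "lexmin K n = Inf {l n |l. l \<in> K \<and> (\<forall>i\<in>{..<n}. l i = lexmin K i)}"

declare lexmin.simps [simp del]

definition lexmin_stage :: "(nat \<Rightarrow> real) set \<Rightarrow> nat \<Rightarrow> (nat \<Rightarrow> real) set" where
  "lexmin_stage K n = {l \<in> K. \<forall>i<n. l i = lexmin K i}"

lemma lexmin_eq: "lexmin K n = Inf ((\<lambda>l. l n) ` lexmin_stage K n)"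
  by (subst lexmin.simps) (auto simp: lexmin_stage_def intro!: arg_cong[where f = Inf])

lemma closed_coordinates_eq: "closed {l :: nat \<Rightarrow> real. \<forall>i<n. l i = c i}"
proof -
  have "closed (\<Inter>i\<in>{..<n}. {l :: nat \<Rightarrow> real. l i = c i})"
    by (intro closed_INT ballI closed_Collect_eq) auto
  also have "(\<Inter>i\<in>{..<n}. {l :: nat \<Rightarrow> real. l i = c i}) = {l. \<forall>i<n. l i = c i}"
    by auto
  finally show ?thesis .
qed

lemma compact_lexmin_stage: "compact K \<Longrightarrow> compact (lexmin_stage K n)"
  using compact_Int_closed[OF _ closed_coordinates_eq[of n "lexmin K"], of K]
  by (simp add: lexmin_stage_def Int_def)

lemma lexmin_stage_min:
  assumes "compact K" "lexmin_stage K n \<noteq> {}"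
  obtains l where "l \<in> lexmin_stage K n" "l n = lexmin K n"
    "\<And>l'. l' \<in> lexmin_stage K n \<Longrightarrow> lexmin K n \<le> l' n"
proof -
  have "continuous_on (lexmin_stage K n) (\<lambda>l. l n)"
    by (rule continuous_on_subset[OF continuous_on_product_coordinates]) simp
  then obtain l where l: "l \<in> lexmin_stage K n" "\<forall>l'\<in>lexmin_stage K n. l n \<le> l' n"
    using continuous_attains_inf[OF compact_lexmin_stage[OF assms(1)] assms(2), of "\<lambda>l. l n"]
    by blast
  have "lexmin K n = l n"
    unfolding lexmin_eq using l by (intro cInf_eq_minimum) auto
  with l that show ?thesis by auto
qed

lemma lexmin_stage_nonempty:
  assumes "compact K" "K \<noteq> {}"
  shows "lexmin_stage K n \<noteq> {}"
proof (induction n)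
  case 0
  then show ?case using assms by (simp add: lexmin_stage_def)
next
  case (Suc n)
  from lexmin_stage_min[OF assms(1) this] obtain l
    where "l \<in> lexmin_stage K n" "l n = lexmin K n" by metis
  then have "l \<in> lexmin_stage K (Suc n)"
    by (auto simp: lexmin_stage_def less_Suc_eq)
  then show ?case by blast
qed

text \<open>The stages are nested, nonempty and compact, so they have a common point; it agrees with
  \<open>lexmin K\<close> in every coordinate.\<close>

lemma lexmin_mem:
  assumes "compact K" "K \<noteq> {}"
  shows "lexmin K \<in> K"
proof -
  have "K \<inter> (\<Inter>n. {l. \<forall>i<n. l i = lexmin K i}) \<noteq> {}"
    using lexmin_stage_nonempty[OF assms]
    by (intro compact_Int_decseq_nonempty assms closed_coordinates_eq)
       (auto simp: decseq_def lexmin_stage_def)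
  then obtain l where "l \<in> K" "\<forall>n. \<forall>i<n. l i = lexmin K i" by auto
  then have "l = lexmin K" by auto
  with \<open>l \<in> K\<close> show ?thesis by simp
qed

text \<open>No member of a stage goes below the next minimum, so inequalities
  \<open>l i \<le> lexmin K i\<close> force equality one index at a time. This trades the equations
  that define a stage for upper bounds, the only kind of condition whose measurability has to be
  known later.\<close>

lemma le_lexmin_iff_stage:
  assumes "compact K" "K \<noteq> {}"
  shows "(l \<in> K \<and> (\<forall>i<n. l i \<le> lexmin K i)) \<longleftrightarrow> l \<in> lexmin_stage K n"
proof (induction n)
  case 0
  then show ?case by (simp add: lexmin_stage_def)
next
  case (Suc n)
  have "l \<in> lexmin_stage K n \<Longrightarrow> lexmin K n \<le> l n"
    using lexmin_stage_min[OF assms(1) lexmin_stage_nonempty[OF assms], of n] by metis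
  with Suc show ?case
    by (auto simp: lexmin_stage_def less_Suc_eq)
qed

lemma lexmin_le_iff:
  assumes "compact K" "K \<noteq> {}"
  shows "lexmin K n \<le> a \<longleftrightarrow> (\<exists>l\<in>K. (\<forall>i<n. l i \<le> lexmin K i) \<and> l n \<le> a)"
  using lexmin_stage_min[OF assms(1) lexmin_stage_nonempty[OF assms], of n]
    le_lexmin_iff_stage[OF assms, of _ n]
  by (metis order_trans)

lemma all_less_Suc: "(\<forall>i<Suc n. P i) \<longleftrightarrow> (\<forall>i<n. P i) \<and> P n"
  by (auto simp: less_Suc_eq)

text \<open>A sublevel set of the \<open>n\<close>-th minimum consists of the points where
  \<open>K w\<close> meets a region given by upper bounds on the first \<open>Suc n\<close>
  coordinates. The bounds are the earlier minima, measurable by induction, and a constant; this is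
  why the hypothesis allows measurable bounds \<open>c i\<close>.\<close>

lemma lexmin_measurable:
  assumes K: "\<And>w. w \<in> space M \<Longrightarrow> compact (K w) \<and> K w \<noteq> {}"
    and meas: "\<And>n c. (\<And>i. c i \<in> borel_measurable M) \<Longrightarrow>
      {w \<in> space M. \<exists>l\<in>K w. \<forall>i<n. l i \<le> c i w} \<in> sets M"
  shows "(\<lambda>w. lexmin (K w) n) \<in> borel_measurable M"
proof (induction n rule: less_induct)
  case (less n)
  show ?case
  proof (rule borel_measurableI_le)
    fix a :: real
    define c where "c i w = (if i < n then lexmin (K w) i else a)" for i w
    have "{w \<in> space M. lexmin (K w) n \<le> a} =
        {w \<in> space M. \<exists>l\<in>K w. \<forall>i<Suc n. l i \<le> c i w}"
      using K by (intro Collect_cong conj_cong refl)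
        (simp add: lexmin_le_iff c_def all_less_Suc cong: conj_cong all_cong)
    also have "\<dots> \<in> sets M"
    proof (rule meas)
      show "c i \<in> borel_measurable M" for i
        unfolding c_def using less.IH[of i] by (cases "i < n") auto
    qed
    finally show "{w \<in> space M. lexmin (K w) n \<le> a} \<in> sets M" .
  qed
qed

section \<open>Convex representations with a prescribed rate of convergence\<close>

text \<open>Positively homogeneous form of a CCG representation, for vectors of any norm. The mass
  is only bounded by \<open>norm y\<close>, one partial sum at a time; equality follows in
  \<open>gen_reps_sums_norm\<close>.\<close>

definition gen_reps :: "(nat \<Rightarrow> 'b::banach) \<Rightarrow> 'b \<Rightarrow> (nat \<Rightarrow> real) set" where
  "gen_reps e y = {l. (\<forall>i. 0 \<le> l i) \<and> (\<forall>p. (\<Sum>i<p. l i) \<le> norm y) \<and> (\<lambda>i. l i *\<^sub>R e i) sums y}"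

text \<open>\<open>N\<close> is the rate: from index \<open>N j\<close> on, partial sums are within
  \<open>(1/2)^j\<close> of \<open>y\<close>. The cutoff \<open>m\<close> leaves finitely many
  inequalities besides the signs, and the slack \<open>d\<close> makes room for rounded
  coefficients.\<close>

definition approx_reps ::
    "(nat \<Rightarrow> 'b::banach) \<Rightarrow> (nat \<Rightarrow> nat) \<Rightarrow> 'b \<Rightarrow> nat \<Rightarrow> real \<Rightarrow> (nat \<Rightarrow> real) set" where
  "approx_reps e N y m d = {l. (\<forall>i. 0 \<le> l i) \<and> (\<forall>p\<le>m. (\<Sum>i<p. l i) \<le> norm y + d) \<and>
     (\<forall>j\<le>m. \<forall>p\<le>m. N j \<le> p \<longrightarrow> norm ((\<Sum>i<p. l i *\<^sub>R e i) - y) \<le> (1/2)^j + d)}"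

definition rate_reps ::
    "(nat \<Rightarrow> 'b::banach) \<Rightarrow> (nat \<Rightarrow> nat) \<Rightarrow> 'b \<Rightarrow> (nat \<Rightarrow> real) set" where
  "rate_reps e N y = (\<Inter>m. approx_reps e N y m 0)"

lemma approx_reps_mono:
  "m \<le> m' \<Longrightarrow> d' \<le> d \<Longrightarrow> approx_reps e N y m' d' \<subseteq> approx_reps e N y m d"
  unfolding approx_reps_def
proof (intro subsetI CollectI conjI allI impI; elim CollectE conjE)
  fix l p assume "m \<le> m'" "d' \<le> d" "p \<le> m" "\<forall>p\<le>m'. (\<Sum>i<p. l i) \<le> norm y + d'"
  then have "(\<Sum>i<p. l i) \<le> norm y + d'" by simp
  with \<open>d' \<le> d\<close> show "(\<Sum>i<p. l i) \<le> norm y + d" by linarith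
next
  fix l j p assume "m \<le> m'" "d' \<le> d" "j \<le> m" "p \<le> m" "N j \<le> p"
    and *: "\<forall>j\<le>m'. \<forall>p\<le>m'. N j \<le> p \<longrightarrow> norm ((\<Sum>i<p. l i *\<^sub>R e i) - y) \<le> (1/2)^j + d'"
  then have "norm ((\<Sum>i<p. l i *\<^sub>R e i) - y) \<le> (1/2)^j + d'" by simp
  with \<open>d' \<le> d\<close> show "norm ((\<Sum>i<p. l i *\<^sub>R e i) - y) \<le> (1/2)^j + d" by linarith
qed simp

lemma rate_reps_iff: "l \<in> rate_reps e N y \<longleftrightarrow> (\<forall>i. 0 \<le> l i) \<and> (\<forall>p. (\<Sum>i<p. l i) \<le> norm y) \<and>
     (\<forall>j p. N j \<le> p \<longrightarrow> norm ((\<Sum>i<p. l i *\<^sub>R e i) - y) \<le> (1/2)^j)"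
proof
  assume l: "l \<in> rate_reps e N y"
  have *: "l \<in> approx_reps e N y m 0" for m
    using l unfolding rate_reps_def by blast
  show "(\<forall>i. 0 \<le> l i) \<and> (\<forall>p. (\<Sum>i<p. l i) \<le> norm y) \<and>
     (\<forall>j p. N j \<le> p \<longrightarrow> norm ((\<Sum>i<p. l i *\<^sub>R e i) - y) \<le> (1/2)^j)"
  proof (intro conjI allI impI)
    show "0 \<le> l i" for i using *[of 0] by (simp add: approx_reps_def)
    show "(\<Sum>i<p. l i) \<le> norm y" for p using *[of p] by (simp add: approx_reps_def)
    show "norm ((\<Sum>i<p. l i *\<^sub>R e i) - y) \<le> (1/2)^j" if "N j \<le> p" for j p
      using *[of "max j p"] that by (simp add: approx_reps_def)
  qed
qed (simp add: rate_reps_def approx_reps_def)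

lemma rate_reps_subset_gen_reps: "rate_reps e N y \<subseteq> gen_reps e y"
proof
  fix l assume l: "l \<in> rate_reps e N y"
  have "(\<lambda>p. \<Sum>i<p. l i *\<^sub>R e i) \<longlonglongrightarrow> y"
  proof (rule metric_LIMSEQ_I)
    fix r :: real assume "r > 0"
    then obtain j where j: "(1/2)^j < r" using real_arch_pow_inv[of r "1/2"] by auto
    show "\<exists>p0. \<forall>p\<ge>p0. dist (\<Sum>i<p. l i *\<^sub>R e i) y < r"
      using l j unfolding rate_reps_iff dist_norm by (intro exI[of _ "N j"]) (meson le_less_trans)
  qed
  with l show "l \<in> gen_reps e y"
    by (simp add: gen_reps_def rate_reps_iff sums_def)
qed

text \<open>The missing inequality \<open>norm y \<le> (\<Sum>i. l i)\<close> is the triangle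
  inequality for the series of vectors.\<close>

lemma gen_reps_sums_norm:
  assumes "l \<in> gen_reps e y" "\<And>i. norm (e i) \<le> 1"
  shows "l sums norm y"
proof -
  have nonneg: "0 \<le> l i" and le: "(\<Sum>i<p. l i) \<le> norm y" and s: "(\<lambda>i. l i *\<^sub>R e i) sums y" for i p
    using assms by (auto simp: gen_reps_def)
  have sum: "summable l" using nonneg le by (rule summableI_nonneg_bounded)
  have "norm (l i *\<^sub>R e i) \<le> l i" for i
    using mult_left_mono[OF assms(2)[of i] nonneg[of i]] nonneg[of i] by simp
  then have "norm (\<Sum>i. l i *\<^sub>R e i) \<le> (\<Sum>i. l i)" by (intro norm_suminf_le sum)
  moreover have "(\<Sum>i. l i) \<le> norm y" using sum nonneg le by (intro suminf_le_const)
  ultimately show ?thesis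
    using summable_sums[OF sum] by (metis sums_unique[OF s] order_antisym)
qed

lemma closed_approx_reps: "closed (approx_reps e N y m d)"
proof -
  have "approx_reps e N y m d = (\<Inter>i. {l. 0 \<le> l i}) \<inter>
      (\<Inter>p\<in>{..m}. {l. (\<Sum>i<p. l i) \<le> norm y + d}) \<inter>
      (\<Inter>j\<in>{..m}. \<Inter>p\<in>{p. p \<le> m \<and> N j \<le> p}.
        {l. norm ((\<Sum>i<p. l i *\<^sub>R e i) - y) \<le> (1/2)^j + d})"
    unfolding approx_reps_def by auto
  then show ?thesis
    by (auto intro!: closed_Int closed_INT closed_Collect_le continuous_intros)
qed

lemma rate_reps_subset_box: "rate_reps e N y \<subseteq> PiE UNIV (\<lambda>i. {0..norm y})"
proof
  fix l assume l: "l \<in> rate_reps e N y"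
  have "l i \<le> norm y" for i
  proof -
    have "l i \<le> (\<Sum>i<Suc i. l i)" using l by (simp add: rate_reps_iff sum_nonneg)
    also have "\<dots> \<le> norm y" using l unfolding rate_reps_iff by blast
    finally show ?thesis .
  qed
  then show "l \<in> PiE UNIV (\<lambda>i. {0..norm y})"
    using l unfolding rate_reps_iff by auto
qed

lemma compact_rate_reps: "compact (rate_reps e N y)"
proof -
  have "closed (rate_reps e N y)"
    unfolding rate_reps_def by (intro closed_INT ballI closed_approx_reps)
  then show ?thesis
    using compact_Int_closed[OF compact_box] rate_reps_subset_box by (metis inf.absorb_iff2)
qed

text \<open>Countably many candidate sequences decide whether a representation with the given rate exists;
  by compactness it suffices to satisfy the first \<open>m\<close> conditions up to \<open>1 / (m + 1)\<close> for every
  \<open>m\<close>.\<close>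

definition grid :: "nat \<Rightarrow> nat list \<Rightarrow> nat \<Rightarrow> real" where
  "grid m xs i = (if i < m then real (xs ! i) / (real m + 1)^2 else 0)"

definition grid_approx ::
  "(nat \<Rightarrow> 'b::banach) \<Rightarrow> (nat \<Rightarrow> nat) \<Rightarrow> nat \<Rightarrow> (nat \<Rightarrow> real) \<Rightarrow> nat \<Rightarrow> 'b \<Rightarrow> nat list \<Rightarrow> bool" where
  "grid_approx e N n c m y xs \<longleftrightarrow> grid m xs \<in> approx_reps e N y m (1 / (real m + 1)) \<and>
     (\<forall>i<n. grid m xs i \<le> c i)"

text \<open>The first \<open>m\<close> coordinates are rounded down to the grid and the others
  replaced by 0. Since no coordinate grows, the bounds \<open>c i\<close> and the mass bound
  persist; only the distance to \<open>y\<close> needs the slack.\<close>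

lemma grid_approx_exists:
  assumes l: "l \<in> approx_reps e N y m 0" and c: "\<forall>i<n. l i \<le> c i" and e: "\<And>i. norm (e i) \<le> 1"
  shows "\<exists>xs. grid_approx e N n c m y xs"
proof -
  \<comment> \<open>At most \<open>m\<close> coordinates are rounded, each by at most
    \<open>1 / R\<close>; the square keeps the total error below the slack
    \<open>1 / (real m + 1)\<close>.\<close>
  define R where "R = (real m + 1)^2"
  have R: "R > 0" by (simp add: R_def)
  define xs where "xs = map (\<lambda>i. nat \<lfloor>l i * R\<rfloor>) [0..<m]"
  have l0: "0 \<le> l i" for i using l by (simp add: approx_reps_def)
  have g: "grid m xs i = of_int \<lfloor>l i * R\<rfloor> / R" if "i < m" for i
    using that l0[of i] R by (simp add: grid_def xs_def R_def)
  have g0: "0 \<le> grid m xs i" for i by (simp add: grid_def)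
  have gl: "grid m xs i \<le> l i" for i
    using g[of i] R l0[of i] by (cases "i < m") (auto simp: pos_divide_le_eq grid_def)
  have lg: "l i - grid m xs i \<le> 1 / R" if "i < m" for i
  proof -
    have "l i * R - of_int \<lfloor>l i * R\<rfloor> \<le> 1" by linarith
    then have "(l i * R - of_int \<lfloor>l i * R\<rfloor>) / R \<le> 1 / R" using R by (simp add: divide_right_mono)
    then show ?thesis using R by (simp add: g[OF that] diff_divide_distrib)
  qed
  have err: "(\<Sum>i<p. l i - grid m xs i) \<le> 1 / (real m + 1)" if "p \<le> m" for p
  proof -
    have "(\<Sum>i<p. l i - grid m xs i) \<le> (\<Sum>i<p. 1 / R)"
      using that by (intro sum_mono lg) auto
    also have "\<dots> \<le> (real m + 1) / R" using that R by (simp add: divide_right_mono)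
    also have "\<dots> = 1 / (real m + 1)" by (simp add: R_def power2_eq_square)
    finally show ?thesis .
  qed
  have "(\<Sum>i<p. grid m xs i) \<le> norm y + 1 / (real m + 1)" if "p \<le> m" for p
  proof -
    have "(\<Sum>i<p. grid m xs i) \<le> (\<Sum>i<p. l i)" by (intro sum_mono gl)
    also have "\<dots> \<le> norm y" using l that by (simp add: approx_reps_def)
    finally show ?thesis by (simp add: add_increasing2)
  qed
  moreover have "norm ((\<Sum>i<p. grid m xs i *\<^sub>R e i) - y) \<le> (1/2)^j + 1 / (real m + 1)"
    if "p \<le> m" "j \<le> m" "N j \<le> p" for p j
  proof -
    have "norm ((\<Sum>i<p. (l i - grid m xs i) *\<^sub>R e i)) \<le> (\<Sum>i<p. l i - grid m xs i)"
    proof (rule sum_norm_le)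
      fix i
      have "\<bar>l i - grid m xs i\<bar> * norm (e i) \<le> \<bar>l i - grid m xs i\<bar> * 1"
        by (intro mult_left_mono e) auto
      then show "norm ((l i - grid m xs i) *\<^sub>R e i) \<le> l i - grid m xs i"
        using gl[of i] by simp
    qed
    also note err[OF that(1)]
    finally have "norm ((\<Sum>i<p. (l i - grid m xs i) *\<^sub>R e i)) \<le> 1 / (real m + 1)" .
    moreover have "norm ((\<Sum>i<p. l i *\<^sub>R e i) - y) \<le> (1/2)^j"
      using l that by (simp add: approx_reps_def)
    moreover have "(\<Sum>i<p. grid m xs i *\<^sub>R e i) - y =
        ((\<Sum>i<p. l i *\<^sub>R e i) - y) - (\<Sum>i<p. (l i - grid m xs i) *\<^sub>R e i)"
      by (simp add: scaleR_left_diff_distrib sum_subtractf)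
    ultimately show ?thesis
      using norm_triangle_ineq4[of "(\<Sum>i<p. l i *\<^sub>R e i) - y"
          "\<Sum>i<p. (l i - grid m xs i) *\<^sub>R e i"] by (simp only:)
  qed
  moreover have "\<forall>i<n. grid m xs i \<le> c i" using order_trans[OF gl] c by simp
  ultimately show ?thesis
    unfolding grid_approx_def approx_reps_def using g0 by (intro exI[of _ xs]) simp
qed

text \<open>For the converse, the sets \<open>F m\<close> are closed and decrease, because the
  cutoff grows while the slack shrinks. The grid points show that each meets the compact box, and
  for a common point the slack tends to 0.\<close>

lemma rate_reps_iff_grid_approx:
  assumes e: "\<And>i. norm (e i) \<le> 1"
  shows "(\<exists>l\<in>rate_reps e N y. \<forall>i<n. l i \<le> c i) \<longleftrightarrow> (\<forall>m. \<exists>xs. grid_approx e N n c m y xs)"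
proof
  assume "\<exists>l\<in>rate_reps e N y. \<forall>i<n. l i \<le> c i"
  then obtain l where l: "l \<in> rate_reps e N y" "\<forall>i<n. l i \<le> c i" by blast
  have "l \<in> approx_reps e N y m 0" for m using l(1) by (simp add: rate_reps_def)
  then show "\<forall>m. \<exists>xs. grid_approx e N n c m y xs"
    by (intro allI grid_approx_exists[OF _ l(2) e])
next
  assume ex: "\<forall>m. \<exists>xs. grid_approx e N n c m y xs"
  \<comment> \<open>The slack never exceeds 1, so one box holds the grid points of all
    levels.\<close>
  define B where "B = PiE UNIV (\<lambda>i::nat. {0..norm y + 1})"
  define C where "C = {l :: nat \<Rightarrow> real. \<forall>i<n. l i \<le> c i}"
  define F where "F m = approx_reps e N y m (1 / (real m + 1)) \<inter> C" for m
  have "closed (\<Inter>i\<in>{..<n}. {l :: nat \<Rightarrow> real. l i \<le> c i})"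
    by (intro closed_INT ballI closed_Collect_le) auto
  also have "(\<Inter>i\<in>{..<n}. {l :: nat \<Rightarrow> real. l i \<le> c i}) = C" by (auto simp: C_def)
  finally have "closed C" .
  have "B \<inter> (\<Inter>m. F m) \<noteq> {}"
  proof (rule compact_Int_decseq_nonempty)
    show "compact B" unfolding B_def by (rule compact_box)
    show "closed (F m)" for m
      unfolding F_def by (intro closed_Int closed_approx_reps \<open>closed C\<close>)
    show "decseq F"
      unfolding decseq_def F_def by (intro allI impI Int_mono approx_reps_mono) (auto simp: frac_le)
    fix m
    obtain xs where xs: "grid_approx e N n c m y xs" using ex by blast
    have "grid m xs i \<le> norm y + 1" for i
    proof (cases "i < m")
      case True
      have "grid m xs i \<le> (\<Sum>i<Suc i. grid m xs i)" by (simp add: grid_def sum_nonneg)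
      also have "\<dots> \<le> norm y + 1 / (real m + 1)"
        using xs True unfolding grid_approx_def approx_reps_def by (simp del: sum.lessThan_Suc)
      also have "\<dots> \<le> norm y + 1" by simp
      finally show ?thesis .
    qed (simp add: grid_def add_nonneg_nonneg)
    moreover have "0 \<le> grid m xs i" for i by (simp add: grid_def)
    ultimately have "grid m xs \<in> B" by (auto simp: B_def)
    moreover have "grid m xs \<in> F m" using xs by (simp add: F_def C_def grid_approx_def)
    ultimately show "B \<inter> F m \<noteq> {}" by blast
  qed
  then obtain l where l: "\<And>m. l \<in> F m" by blast
  have lim: "(\<lambda>m. a + 1 / (real m + 1)) \<longlonglongrightarrow> a" for a
    using tendsto_add[OF tendsto_const[of a] LIMSEQ_inverse_real_of_nat]
    by (simp add: inverse_eq_divide add.commute)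
  have "(\<Sum>i<p. l i) \<le> norm y" for p
  proof (rule LIMSEQ_le_const[OF lim], intro exI allI impI)
    fix m assume "p \<le> m"
    with l[of m] show "(\<Sum>i<p. l i) \<le> norm y + 1 / (real m + 1)"
      by (simp add: F_def approx_reps_def)
  qed
  moreover have "norm ((\<Sum>i<p. l i *\<^sub>R e i) - y) \<le> (1/2)^j" if "N j \<le> p" for j p
  proof (rule LIMSEQ_le_const[OF lim], intro exI allI impI)
    fix m assume "max j p \<le> m"
    with that l[of m] show "norm ((\<Sum>i<p. l i *\<^sub>R e i) - y) \<le> (1/2)^j + 1 / (real m + 1)"
      by (simp add: F_def approx_reps_def)
  qed
  ultimately have "l \<in> rate_reps e N y"
    using l[of 0] by (simp add: rate_reps_iff F_def approx_reps_def)
  with l[of 0] show "\<exists>l\<in>rate_reps e N y. \<forall>i<n. l i \<le> c i"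
    by (auto simp: F_def C_def)
qed

text \<open>There are countably many lists, and for a fixed list only finitely many inequalities
  remain. They involve \<open>f\<close> only through \<open>norm (f w)\<close> and the distances of
  \<open>f w\<close> to fixed vectors, which are measurable real functions.\<close>

lemma grid_approx_measurable:
  fixes e :: "nat \<Rightarrow> 'b::banach"
  assumes f: "f \<in> borel_measurable M" and c: "\<And>i. c i \<in> borel_measurable M"
  shows "{w \<in> space M. \<exists>xs. grid_approx e N n (\<lambda>i. c i w) m (f w) xs} \<in> sets M"
proof -
  have [measurable]: "(\<lambda>w. norm (v - f w)) \<in> borel_measurable M" for v
    by (rule measurable_compose[OF f])
       (intro borel_measurable_continuous_onI continuous_intros)
  have [measurable]: "(\<lambda>w. norm (f w)) \<in> borel_measurable M"
    by (rule measurable_compose[OF f])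
       (intro borel_measurable_continuous_onI continuous_intros)
  note c [measurable]
  have "{w \<in> space M. grid_approx e N n (\<lambda>i. c i w) m (f w) xs} \<in> sets M" for xs
  proof -
    have "{w \<in> space M. grid_approx e N n (\<lambda>i. c i w) m (f w) xs} =
      {w \<in> space M. (\<forall>p\<in>{..m}. (\<Sum>i<p. grid m xs i) \<le> norm (f w) + 1 / (real m + 1)) \<and>
        (\<forall>j\<in>{..m}. \<forall>p\<in>{p\<in>{..m}. N j \<le> p}.
          norm ((\<Sum>i<p. grid m xs i *\<^sub>R e i) - f w) \<le> (1/2)^j + 1 / (real m + 1)) \<and>
        (\<forall>i\<in>{..<n}. grid m xs i \<le> c i w)}"
      by (auto simp: grid_approx_def approx_reps_def grid_def)
    also have "\<dots> \<in> sets M"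
      by (intro sets.sets_Collect_conj sets.sets_Collect_finite_All borel_measurable_le) measurable
    finally show ?thesis .
  qed
  then show ?thesis
    by (rule sets.sets_Collect_countable_Ex)
qed

section \<open>Generating coefficients for every vector of a CCG space\<close>

lemma gen_reps_scale:
  assumes "l \<in> gen_reps e y" "0 \<le> c"
  shows "(\<lambda>i. c * l i) \<in> gen_reps e (c *\<^sub>R y)"
proof -
  have "(\<lambda>i. c *\<^sub>R (l i *\<^sub>R e i)) sums (c *\<^sub>R y)"
    using assms by (intro sums_scaleR_right) (simp add: gen_reps_def)
  then show ?thesis
    using assms by (auto simp: gen_reps_def mult_left_mono simp flip: sum_distrib_left)
qed

lemma CCG_gen_reps:
  assumes "CCG (TYPE('b::banach))"
  obtains e :: "nat \<Rightarrow> 'b::banach" where "\<And>i. norm (e i) = 1" "\<And>y. gen_reps e y \<noteq> {}"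
proof -
  obtain e :: "nat \<Rightarrow> 'b" where e: "range e \<subseteq> sphere 0 1"
    and l: "\<And>y. y \<in> sphere 0 1 \<Longrightarrow>
      \<exists>l :: nat \<Rightarrow> real. (\<forall>n. 0 \<le> l n) \<and> l sums 1 \<and> (\<lambda>n. l n *\<^sub>R e n) sums y"
    using assms unfolding CCG_def by blast
  have "gen_reps e y \<noteq> {}" for y
  proof (cases "y = 0")
    case True
    then have "(\<lambda>i. 0) \<in> gen_reps e y" by (simp add: gen_reps_def)
    then show ?thesis by blast
  next
    case False
    then obtain l where l: "\<forall>n. 0 \<le> l n" "l sums 1" "(\<lambda>n. l n *\<^sub>R e n) sums (y /\<^sub>R norm y)"
      using l[of "y /\<^sub>R norm y"] by auto
    have "(\<Sum>i<p. l i) \<le> 1" for p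
      using l(1) sum_le_suminf[OF sums_summable[OF l(2)], of "{..<p}"] sums_unique[OF l(2)] by simp
    with l False have "l \<in> gen_reps e (y /\<^sub>R norm y)"
      by (simp add: gen_reps_def)
    from gen_reps_scale[OF this norm_ge_zero[of y]] False show ?thesis by auto
  qed
  moreover have "norm (e i) = 1" for i using e by (auto simp: subset_iff)
  ultimately show ?thesis using that by blast
qed

section \<open>Measurable selection of representations\<close>

text \<open>The sets below need not be measurable, hence the outer measure.\<close>

lemma outer_measure_uniform_rate:
  fixes e :: "nat \<Rightarrow> 'b::banach"
  assumes ne: "\<And>y. gen_reps e y \<noteq> {}"
    and t: "t < emeasure M (space M)"
  shows "\<exists>N. \<forall>m. t < outer_measure_of M {w \<in> space M. \<exists>l\<in>gen_reps e (f w).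
      \<forall>j<m. \<forall>p\<ge>N j. norm ((\<Sum>i<p. l i *\<^sub>R e i) - f w) \<le> (1/2)^j}"
proof -
  \<comment> \<open>Pairs of a point and a representation are recorded, not points alone, so that
    one and the same \<open>l\<close> meets all the conditions imposed so far.\<close>
  define Z0 where "Z0 = {(w, l). w \<in> space M \<and> l \<in> gen_reps e (f w)}"
  define R where "R n q = {(w, l). \<forall>p\<ge>q. norm ((\<Sum>i<p. l i *\<^sub>R e i) - f w) \<le> (1/2)^n}"
    for n q :: nat
  \<comment> \<open>A state holds an index and the surviving pairs. The invariant \<open>P\<close>
    keeps the outer measure of their projection strictly above \<open>t\<close>; \<open>Q\<close>
    says that the index stored in the next state restricts the pairs by the \<open>n\<close>-th
    condition.\<close>
  define P where "P n x \<longleftrightarrow> snd x \<subseteq> Z0 \<and> t < outer_measure_of M (fst ` snd x)"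
    for n :: nat and x :: "nat \<times> ('a \<times> (nat \<Rightarrow> real)) set"
  define Q where "Q n x x' \<longleftrightarrow> snd x' = snd x \<inter> R n (fst x')"
    for n and x x' :: "nat \<times> ('a \<times> (nat \<Rightarrow> real)) set"
  have "\<exists>F. \<forall>n. P n (F n) \<and> Q n (F n) (F (Suc n))"
  proof (rule dependent_nat_choice)
    have "fst ` Z0 = space M" using ne by (force simp: Z0_def)
    \<comment> \<open>The index 0 is a placeholder: \<open>Q\<close> reads the index of the later
      state only.\<close>
    then show "\<exists>x. P 0 x" using t by (intro exI[of _ "(0, Z0)"]) (simp add: P_def)
  next
    fix x n assume x: "P n x"
    define A where "A q = fst ` (snd x \<inter> R n q)" for q
    have sub: "snd x \<subseteq> Z0" using x by (simp add: P_def)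
    \<comment> \<open>For each surviving pair the series converges, so some \<open>q\<close> serves
      that pair. Hence the sets \<open>A q\<close> increase to the whole projection, and one of them
      keeps outer measure above \<open>t\<close>.\<close>
    have "(SUP q. outer_measure_of M (A q)) = outer_measure_of M (\<Union>q. A q)"
    proof (rule SUP_outer_measure_of_incseq)
      show "A q \<subseteq> space M" for q using sub by (auto simp: A_def Z0_def)
      show "incseq A" unfolding incseq_def A_def R_def by (intro allI impI image_mono) auto
    qed
    also have "(\<Union>q. A q) = fst ` snd x"
    proof
      show "fst ` snd x \<subseteq> (\<Union>q. A q)"
      proof
        fix w assume "w \<in> fst ` snd x"
        then obtain l where wl: "(w, l) \<in> snd x" by auto
        with sub have "(\<lambda>i. l i *\<^sub>R e i) sums f w" by (auto simp: Z0_def gen_reps_def)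
        then obtain q where "\<forall>p\<ge>q. norm ((\<Sum>i<p. l i *\<^sub>R e i) - f w) < (1/2)^n"
          using LIMSEQ_D[of "\<lambda>p. \<Sum>i<p. l i *\<^sub>R e i" "f w" "(1/2)^n"] by (auto simp: sums_def)
        then have "(w, l) \<in> R n q" by (auto simp: R_def intro: less_imp_le)
        with wl show "w \<in> (\<Union>q. A q)" unfolding A_def by force
      qed
    qed (auto simp: A_def)
    finally have "t < (SUP q. outer_measure_of M (A q))" using x by (simp add: P_def)
    then obtain q where "t < outer_measure_of M (A q)" by (auto simp: less_SUP_iff)
    then show "\<exists>y. P (Suc n) y \<and> Q n x y"
      using sub by (intro exI[of _ "(q, snd x \<inter> R n q)"]) (auto simp: P_def Q_def A_def)
  qed
  then obtain F where F: "\<And>n. P n (F n)" "\<And>n. Q n (F n) (F (Suc n))" by blast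
  \<comment> \<open>The index for condition \<open>j\<close> is chosen on the way from state
    \<open>j\<close> to state \<open>Suc j\<close> and stored in the latter.\<close>
  define N where "N j = fst (F (Suc j))" for j
  have "snd (F m) \<subseteq> Z0 \<inter> (\<Inter>j\<in>{..<m}. R j (N j))" for m
  proof (induction m)
    case 0
    then show ?case using F(1)[of 0] by (simp add: P_def)
  next
    case (Suc m)
    then show ?case using F(2)[of m] by (auto simp: Q_def N_def lessThan_Suc)
  qed
  then have "fst ` snd (F m) \<subseteq> {w \<in> space M. \<exists>l\<in>gen_reps e (f w).
      \<forall>j<m. \<forall>p\<ge>N j. norm ((\<Sum>i<p. l i *\<^sub>R e i) - f w) \<le> (1/2)^j}" for m
    by (fastforce simp: Z0_def R_def)
  then have "outer_measure_of M (fst ` snd (F m)) \<le> outer_measure_of M {w \<in> space M.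
      \<exists>l\<in>gen_reps e (f w). \<forall>j<m. \<forall>p\<ge>N j. norm ((\<Sum>i<p. l i *\<^sub>R e i) - f w) \<le> (1/2)^j}" for m
    by (intro outer_measure_of_mono)
  then show ?thesis
    using F(1) by (intro exI[of _ N] allI) (auto simp: P_def intro: less_le_trans)
qed

text \<open>With the rate \<open>N\<close> fixed, solvability of the first conditions on the grid is
  measurable and holds on sets \<open>G m\<close> of measure at least \<open>t\<close>. The
  representations behind different \<open>m\<close> may differ; compactness replaces them by one
  that satisfies all conditions on the intersection \<open>D\<close>, where the lexicographic
  minimum is then selected.\<close>

lemma gen_reps_selection_large:
  fixes e :: "nat \<Rightarrow> 'b::banach"
  assumes fin: "finite_measure M" and f: "f \<in> borel_measurable M"
    and e: "\<And>i. norm (e i) \<le> 1" and ne: "\<And>y. gen_reps e y \<noteq> {}"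
    and t: "t < emeasure M (space M)"
  obtains D c where "D \<in> sets M" "t \<le> emeasure M D" "\<And>i. c i \<in> borel_measurable M"
    "\<And>w. w \<in> D \<Longrightarrow> (\<lambda>i. c i w) \<in> gen_reps e (f w)"
proof -
  interpret finite_measure M by fact
  obtain N where N: "\<And>m. t < outer_measure_of M {w \<in> space M. \<exists>l\<in>gen_reps e (f w).
      \<forall>j<m. \<forall>p\<ge>N j. norm ((\<Sum>i<p. l i *\<^sub>R e i) - f w) \<le> (1/2)^j}"
    using outer_measure_uniform_rate[OF ne t] by blast
  \<comment> \<open>With \<open>n = 0\<close> no coordinate is bounded, so this is pure solvability
    at level \<open>m\<close>.\<close>
  define C where "C m = {w \<in> space M. \<exists>xs. grid_approx e N 0 (\<lambda>i. 0) m (f w) xs}" for m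
  define G where "G m = (\<Inter>k\<in>{..m}. C k)" for m
  define D where "D = (\<Inter>m. G m)"
  have C: "C m \<in> sets M" for m
    unfolding C_def using grid_approx_measurable[OF f, of "\<lambda>i w. 0"] by simp
  then have G: "G m \<in> sets M" for m unfolding G_def by (intro sets.finite_INT) auto
  then have D: "D \<in> sets M" unfolding D_def by (intro sets.countable_INT) auto
  have "t \<le> emeasure M (G m)" for m
  proof -
    have "{w \<in> space M. \<exists>l\<in>gen_reps e (f w).
      \<forall>j<Suc m. \<forall>p\<ge>N j. norm ((\<Sum>i<p. l i *\<^sub>R e i) - f w) \<le> (1/2)^j} \<subseteq> G m"
    proof
      fix w assume "w \<in> {w \<in> space M. \<exists>l\<in>gen_reps e (f w).
        \<forall>j<Suc m. \<forall>p\<ge>N j. norm ((\<Sum>i<p. l i *\<^sub>R e i) - f w) \<le> (1/2)^j}"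
      then obtain l where w: "w \<in> space M" and l: "l \<in> gen_reps e (f w)"
        "\<forall>j<Suc m. \<forall>p\<ge>N j. norm ((\<Sum>i<p. l i *\<^sub>R e i) - f w) \<le> (1/2)^j" by blast
      have "l \<in> approx_reps e N (f w) k 0" if "k \<le> m" for k
        using l that by (simp add: approx_reps_def gen_reps_def)
      then have "\<exists>xs. grid_approx e N 0 (\<lambda>i. 0) k (f w) xs" if "k \<le> m" for k
        using that by (intro grid_approx_exists[OF _ _ e]) auto
      with w show "w \<in> G m" by (simp add: G_def C_def)
    qed
    from outer_measure_of_mono[OF this, of M] N[of "Suc m"] G[of m] show ?thesis
      by simp
  qed
  \<comment> \<open>Continuity from above, where finiteness of the measure enters.\<close>
  moreover have "(INF m. emeasure M (G m)) = emeasure M (\<Inter>m. G m)"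
    using G by (intro INF_emeasure_decseq) (auto simp: decseq_def G_def)
  ultimately have tD: "t \<le> emeasure M D" by (metis D_def INF_greatest)
  have rate: "{w \<in> space M. \<exists>l\<in>rate_reps e N (f w). \<forall>i<n. l i \<le> c i w} =
      (\<Inter>m. {w \<in> space M. \<exists>xs. grid_approx e N n (\<lambda>i. c i w) m (f w) xs})" for n c
    using rate_reps_iff_grid_approx[of e N, OF e] by auto
  have Drate: "D = {w \<in> space M. rate_reps e N (f w) \<noteq> {}}"
  proof -
    have "D = (\<Inter>m. C m)" by (auto simp: D_def G_def)
    also have "\<dots> = {w \<in> space M. \<exists>l\<in>rate_reps e N (f w). \<forall>i<0. l i \<le> 0}"
      unfolding rate C_def ..
    finally show ?thesis by auto
  qed
  \<comment> \<open>Off \<open>D\<close> the singleton of the zero sequence keeps \<open>K w\<close>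
    compact and nonempty, as \<open>lexmin_measurable\<close> demands at every point; a bound
    \<open>l i \<le> c i w\<close> then reads \<open>0 \<le> c i w\<close>.\<close>
  define K where "K w = (if w \<in> D then rate_reps e N (f w) else {\<lambda>i. 0})" for w
  have K: "compact (K w) \<and> K w \<noteq> {}" for w
    by (auto simp: K_def compact_rate_reps) (simp add: Drate)
  have "(\<lambda>w. lexmin (K w) i) \<in> borel_measurable M" for i
  proof (rule lexmin_measurable)
    fix n and c :: "nat \<Rightarrow> 'a \<Rightarrow> real" assume c: "\<And>i. c i \<in> borel_measurable M"
    note c [measurable] D [measurable]
    have "{w \<in> space M. \<exists>l\<in>K w. \<forall>i<n. l i \<le> c i w} =
       (D \<inter> {w \<in> space M. \<exists>l\<in>rate_reps e N (f w). \<forall>i<n. l i \<le> c i w}) \<union>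
       ({w \<in> space M. \<forall>i\<in>{..<n}. 0 \<le> c i w} - D)"
      by (auto simp: K_def)
    also have "\<dots> \<in> sets M"
      unfolding rate using D grid_approx_measurable[OF f c]
      by (intro sets.Un sets.Int sets.Diff sets.countable_INT sets.sets_Collect_finite_All
          borel_measurable_le) auto
    finally show "{w \<in> space M. \<exists>l\<in>K w. \<forall>i<n. l i \<le> c i w} \<in> sets M" .
  qed (rule K)
  moreover have "(\<lambda>i. lexmin (K w) i) \<in> gen_reps e (f w)" if "w \<in> D" for w
    using lexmin_mem[of "K w"] K[of w] that rate_reps_subset_gen_reps[of e N "f w"]
    by (auto simp: K_def)
  ultimately show ?thesis by (rule that[OF D tD, of "\<lambda>i w. lexmin (K w) i"])
qed

text \<open>Sets \<open>D m\<close> with measures approaching that of the space cover it up to a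
  null set; the selections are glued by using the first \<open>D m\<close> that contains the
  point.\<close>

lemma gen_reps_selection_finite:
  fixes e :: "nat \<Rightarrow> 'b::banach"
  assumes fin: "finite_measure M" and f: "f \<in> borel_measurable M"
    and e: "\<And>i. norm (e i) \<le> 1" and ne: "\<And>y. gen_reps e y \<noteq> {}"
  obtains x where "\<And>i. x i \<in> borel_measurable M"
    "AE w in M. (\<lambda>i. x i w) \<in> gen_reps e (f w)"
proof (cases "emeasure M (space M) = 0")
  case True
  then have "AE w in M. (\<lambda>i. 0) \<in> gen_reps e (f w)"
    by (intro AE_I'[of "space M"]) (auto simp: null_sets_def)
  then show ?thesis using that[of "\<lambda>i w. 0"] by simp
next
  case False
  interpret finite_measure M by fact
  \<comment> \<open>\<open>ennreal\<close> sends negative numbers to 0, which is still strictly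
    below the measure of the space because that is positive in this case.\<close>
  define t where "t m = ennreal (measure M (space M) - 1 / (real m + 1))" for m
  have pos: "0 < measure M (space M)" using False by (simp add: emeasure_eq_measure measure_nonneg less_le)
  have t: "t m < emeasure M (space M)" for m
    unfolding t_def emeasure_eq_measure using pos by (intro ennreal_lessI) auto
  have "\<exists>D c. D \<in> sets M \<and> t m \<le> emeasure M D \<and> (\<forall>i. c i \<in> borel_measurable M) \<and>
    (\<forall>w\<in>D. (\<lambda>i. c i w) \<in> gen_reps e (f w))" for m
    using gen_reps_selection_large[OF fin f e ne t[of m]] by (metis (no_types))
  then obtain D c where D: "\<And>m. D m \<in> sets M" "\<And>m. t m \<le> emeasure M (D m)"
    and c: "\<And>m i. c m i \<in> borel_measurable M"
      "\<And>m w. w \<in> D m \<Longrightarrow> (\<lambda>i. c m i w) \<in> gen_reps e (f w)"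
    by metis
  define U where "U = (\<Union>m. D m)"
  have U: "U \<in> sets M" unfolding U_def using D by auto
  have "measure M (space M) - 1 / (real m + 1) \<le> measure M U" for m
  proof -
    have "t m \<le> emeasure M U"
      using D(2)[of m] emeasure_mono[of "D m" U M] U by (auto simp: U_def intro: order_trans)
    then show ?thesis unfolding t_def emeasure_eq_measure by (simp add: measure_nonneg)
  qed
  moreover have "(\<lambda>m. measure M (space M) - 1 / (real m + 1)) \<longlonglongrightarrow> measure M (space M)"
    using tendsto_diff[OF tendsto_const[of "measure M (space M)"] LIMSEQ_inverse_real_of_nat]
    by (simp add: inverse_eq_divide add.commute)
  ultimately have "measure M (space M) \<le> measure M U"
    by (intro LIMSEQ_le_const2[of _ "measure M (space M)"]) auto
  then have "measure M (space M - U) = 0"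
    using finite_measure_compl[OF U] bounded_measure[of U] by simp
  then have "space M - U \<in> null_sets M" using U by (simp add: null_sets_def emeasure_eq_measure)
  then have AE: "AE w in M. w \<in> U" by (intro AE_I'[of "space M - U"]) auto
  \<comment> \<open>Outside \<open>U\<close> the value of \<open>LEAST\<close> is irrelevant, as
    this is a null set.\<close>
  define k where "k w = (LEAST m. w \<in> D m)" for w
  note D(1) [measurable]
  have "k \<in> measurable M (count_space UNIV)" unfolding k_def by measurable
  then have "(\<lambda>w. c (k w) i w) \<in> borel_measurable M" for i
    by (rule measurable_compose_countable[OF c(1)])
  moreover have "(\<lambda>i. c (k w) i w) \<in> gen_reps e (f w)" if "w \<in> U" for w
  proof -
    have "w \<in> D (k w)" using that unfolding U_def k_def by (auto intro: LeastI)
    then show ?thesis by (rule c(2))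
  qed
  ultimately show ?thesis
    using AE by (intro that[of "\<lambda>i w. c (k w) i w"]) auto
qed

text \<open>Integrability of \<open>norm (f w)\<close> makes the measure with this density finite,
  whatever \<open>M\<close> is. Its null sets are negligible for \<open>M\<close> on the set where
  \<open>f\<close> does not vanish.\<close>

lemma gen_reps_selection:
  fixes e :: "nat \<Rightarrow> 'b::banach"
  assumes f: "f \<in> borel_measurable M" and int: "integrable M (\<lambda>w. norm (f w))"
    and e: "\<And>i. norm (e i) \<le> 1" and ne: "\<And>y. gen_reps e y \<noteq> {}"
  obtains x where "\<And>i. x i \<in> borel_measurable M"
    "AE w in M. (\<lambda>i. x i w) \<in> gen_reps e (f w)"
proof -
  define M' where "M' = density M (\<lambda>w. ennreal (norm (f w)))"
  have nf [measurable]: "(\<lambda>w. norm (f w)) \<in> borel_measurable M" using int by simp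
  have meas: "g \<in> borel_measurable M' \<longleftrightarrow> g \<in> borel_measurable M" for g :: "'a \<Rightarrow> 'c::topological_space"
    by (simp add: M'_def measurable_def)
  have "emeasure M' (space M') < \<infinity>"
    using int by (simp add: M'_def emeasure_density integrable_iff_bounded
        cong: nn_integral_cong)
  then have "finite_measure M'" by (intro finite_measureI) auto
  moreover have "space M' = space M" by (simp add: M'_def)
  ultimately obtain x where x: "\<And>i. x i \<in> borel_measurable M'"
    "AE w in M'. (\<lambda>i. x i w) \<in> gen_reps e (f w)"
    using gen_reps_selection_finite[of M' f e] f e ne meas[of f] by metis
  \<comment> \<open>The density says nothing about the zeros of \<open>f\<close>; there the zero
    sequence is a representation.\<close>
  define x' where "x' i w = (if norm (f w) = 0 then 0 else x i w)" for i w
  have xm [measurable]: "x i \<in> borel_measurable M" for i using x(1) meas by blast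
  have "AE w in M. 0 < norm (f w) \<longrightarrow> (\<lambda>i. x i w) \<in> gen_reps e (f w)"
    using x(2) unfolding M'_def by (subst (asm) AE_density) auto
  then have "AE w in M. (\<lambda>i. x' i w) \<in> gen_reps e (f w)"
  proof eventually_elim
    case (elim w)
    then show ?case by (cases "norm (f w) = 0") (auto simp: x'_def gen_reps_def)
  qed
  moreover have "x' i \<in> borel_measurable M" for i unfolding x'_def by measurable
  ultimately show ?thesis using that by blast
qed

section \<open>The projective norm as an integral\<close>

abbreviation L1_class :: "'a measure \<Rightarrow> ('a \<Rightarrow> real) \<Rightarrow> ('a \<Rightarrow> real) set" where
  "L1_class M f \<equiv> ae_rel M `` {f}"

abbreviation L1_tensor :: "'a measure \<Rightarrow> (('a \<Rightarrow> real) set, 'b::real_normed_vector) tensor nspace" where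
  "L1_tensor M \<equiv> algebraic_tensor_product (L1 M) type_space"

text \<open>The identification of tensors with functions, kept as a relation: presentations and
  members of the classes can be chosen in many ways, and \<open>f\<close> is determined only almost
  everywhere (\<open>represents_unique\<close>).\<close>

definition represents ::
  "'a measure \<Rightarrow> (('a \<Rightarrow> real) set, 'b::real_normed_vector) tensor \<Rightarrow> ('a \<Rightarrow> 'b) \<Rightarrow> bool" where
  "represents M t f \<longleftrightarrow> (\<exists>n x y. (\<forall>i. integrable M (x i)) \<and>
     t = tensor_sum (L1 M) type_space n (\<lambda>i. L1_class M (x i)) y \<and>
     f = (\<lambda>w. \<Sum>i<n. x i w *\<^sub>R y i))"

lemmas seminormed_L1 = normed_space.axioms(1)[OF normed_space_L1]
lemmas seminormed_type_space = normed_space.axioms(1)[OF normed_space_type_space]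
lemmas seminormed_L1_tensor =
  seminormed_space_algebraic_tensor_product[OF seminormed_L1 seminormed_type_space]

lemma type_space_simps [simp]:
  "carrier type_space = UNIV" "vadd type_space = (+)" "vscale type_space = scaleR"
  "vnorm type_space = norm"
  by (simp_all add: type_space_def)

lemma sum_lessThan_add:
  fixes n m :: nat
  shows "(\<Sum>i<n+m. h i) = (\<Sum>i<n. h i) + (\<Sum>i<m. h (n + i) :: 'c::comm_monoid_add)"
  by (induction m) (auto simp: add.assoc)

lemma L1_carrier_choice:
  assumes "\<forall>i<n. x i \<in> carrier (L1 M)"
  shows "\<exists>x'. (\<forall>i. integrable M (x' i)) \<and> (\<forall>i<n. x i = L1_class M (x' i))"
proof -
  have "\<exists>x'. integrable M x' \<and> (i < n \<longrightarrow> x i = L1_class M x')" for i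
  proof (cases "i < n")
    case True
    with assms have "x i \<in> carrier (L1 M)" by simp
    then show ?thesis by (rule L1_carrierE) blast
  qed (auto intro: exI[of _ "\<lambda>w. 0"])
  then have "\<exists>x'. \<forall>i. integrable M (x' i) \<and> (i < n \<longrightarrow> x i = L1_class M (x' i))"
    by (intro choice allI)
  then show ?thesis by blast
qed

lemma represents_carrier:
  assumes "represents M t f" shows "t \<in> carrier (L1_tensor M)"
proof -
  obtain n x y where x: "\<And>i. integrable M (x i)"
    and t: "t = tensor_sum (L1 M) type_space n (\<lambda>i. L1_class M (x i)) y"
    using assms unfolding represents_def by blast
  have "\<forall>i<n. L1_class M (x i) \<in> carrier (L1 M) \<and> y i \<in> carrier type_space"
    using x by (simp add: L1_carrierI)
  with t show ?thesis unfolding algebraic_tensor_product_def nspace.simps by blast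
qed

lemma carrier_represents:
  assumes "t \<in> carrier (L1_tensor M)"
  obtains f where "represents M t f"
proof -
  obtain n x y where t: "t = tensor_sum (L1 M) type_space n x y"
    and x: "\<forall>i<n. x i \<in> carrier (L1 M)"
    using assms by (auto simp: algebraic_tensor_product_def)
  obtain x' where x': "\<And>i. integrable M (x' i)" "\<And>i. i < n \<Longrightarrow> x i = L1_class M (x' i)"
    using L1_carrier_choice[OF x] by blast
  have "t = tensor_sum (L1 M) type_space n (\<lambda>i. L1_class M (x' i)) y"
    unfolding t tensor_sum_eq by (intro restrict_ext sum.cong) (auto simp: x'(2))
  then have "represents M t (\<lambda>w. \<Sum>i<n. x' i w *\<^sub>R y i)"
    using x'(1) unfolding represents_def by blast
  then show ?thesis by (rule that)
qed

lemma bilinear_L1_add: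
  assumes "A \<in> bilinear_forms (L1 M) type_space" "integrable M f" "integrable M g"
  shows "A (L1_class M (\<lambda>w. f w + g w)) y = A (L1_class M f) y + A (L1_class M g) y"
  using assms by (simp add: bilinear_forms_def L1_carrierI flip: L1_add_class)

lemma bilinear_L1_scale:
  assumes "A \<in> bilinear_forms (L1 M) type_space" "integrable M f"
  shows "A (L1_class M (\<lambda>w. c * f w)) y = c * A (L1_class M f) y"
  using assms by (simp add: bilinear_forms_def L1_carrierI flip: L1_scale_class)

lemma bilinear_L1_sum:
  assumes A: "A \<in> bilinear_forms (L1 M) type_space" and "\<And>i. i \<in> I \<Longrightarrow> integrable M (f i)"
  shows "A (L1_class M (\<lambda>w. \<Sum>i\<in>I. f i w)) y = (\<Sum>i\<in>I. A (L1_class M (f i)) y)"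
  using assms(2)
proof (induction I rule: infinite_finite_induct)
  case (insert i I)
  then show ?case by (simp add: bilinear_L1_add[OF A])
qed (use bilinear_L1_scale[OF A, of "\<lambda>w. 0" 0] in auto)

lemma bilinear_sum_right:
  assumes A: "A \<in> bilinear_forms (L1 M) type_space" and f: "integrable M f"
  shows "A (L1_class M f) (\<Sum>i\<in>I. c i *\<^sub>R y i) = (\<Sum>i\<in>I. c i * A (L1_class M f) (y i))"
proof -
  have scale: "A (L1_class M f) (a *\<^sub>R v) = a * A (L1_class M f) v" for a v
    using A L1_carrierI[OF f] by (simp add: bilinear_forms_def)
  have add: "A (L1_class M f) (u + v) = A (L1_class M f) u + A (L1_class M f) v" for u v
    using A L1_carrierI[OF f] by (simp add: bilinear_forms_def)
  show ?thesis
    by (induction I rule: infinite_finite_induct) (use scale[of 0] in \<open>auto simp: scale add\<close>)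
qed

lemma represents_add:
  assumes "represents M t f" "represents M u g"
  shows "represents M (vadd (L1_tensor M) t u) (\<lambda>w. f w + g w)"
proof -
  obtain n x y m x' y' where x: "\<And>i. integrable M (x i)" "\<And>i. integrable M (x' i)"
    and t: "t = tensor_sum (L1 M) type_space n (\<lambda>i. L1_class M (x i)) y"
      "u = tensor_sum (L1 M) type_space m (\<lambda>i. L1_class M (x' i)) y'"
    and f: "f = (\<lambda>w. \<Sum>i<n. x i w *\<^sub>R y i)" "g = (\<lambda>w. \<Sum>i<m. x' i w *\<^sub>R y' i)"
    using assms unfolding represents_def by blast
  define x'' where "x'' i = (if i < n then x i else x' (i - n))" for i
  define y'' where "y'' i = (if i < n then y i else y' (i - n))" for i
  have "\<forall>i. integrable M (x'' i)" using x by (simp add: x''_def)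
  moreover have "vadd (L1_tensor M) t u =
      tensor_sum (L1 M) type_space (n + m) (\<lambda>i. L1_class M (x'' i)) y''"
    by (auto simp: algebraic_tensor_product_def t tensor_sum_eq sum_lessThan_add x''_def y''_def
        intro!: restrict_ext)
  moreover have "(\<lambda>w. f w + g w) = (\<lambda>w. \<Sum>i<n+m. x'' i w *\<^sub>R y'' i)"
    by (simp add: f sum_lessThan_add x''_def y''_def)
  ultimately show ?thesis unfolding represents_def by blast
qed

lemma represents_scale:
  assumes "represents M t f"
  shows "represents M (vscale (L1_tensor M) c t) (\<lambda>w. c *\<^sub>R f w)"
proof -
  obtain n x y where x: "\<And>i. integrable M (x i)"
    and t: "t = tensor_sum (L1 M) type_space n (\<lambda>i. L1_class M (x i)) y"
    and f: "f = (\<lambda>w. \<Sum>i<n. x i w *\<^sub>R y i)"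
    using assms unfolding represents_def by blast
  have "vscale (L1_tensor M) c t =
      tensor_sum (L1 M) type_space n (\<lambda>i. L1_class M (\<lambda>w. c * x i w)) y"
    by (auto simp: algebraic_tensor_product_def t tensor_sum_eq bilinear_L1_scale x sum_distrib_left
        intro!: restrict_ext)
  moreover have "\<forall>i. integrable M (\<lambda>w. c * x i w)" using x by simp
  moreover have "(\<lambda>w. c *\<^sub>R f w) = (\<lambda>w. \<Sum>i<n. (c * x i w) *\<^sub>R y i)"
    by (simp add: f scaleR_sum_right)
  ultimately show ?thesis
    unfolding represents_def by (intro exI[of _ n] exI[of _ "\<lambda>i w. c * x i w"] exI[of _ y]) simp
qed

lemma represents_diff:
  assumes "represents M t f" "represents M u g"
  shows "represents M (vadd (L1_tensor M) t (vscale (L1_tensor M) (-1) u)) (\<lambda>w. f w - g w)"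
  using represents_add[OF assms(1) represents_scale[OF assms(2), of "-1"]] by simp

text \<open>The library lemma on sums of measurable functions requires a second countable range, a class
  that \<open>'b\<close> does not belong to.\<close>

lemma borel_measurable_sum_scaleR:
  fixes y :: "nat \<Rightarrow> 'b::real_normed_vector"
  assumes "\<And>i. x i \<in> borel_measurable M"
  shows "(\<lambda>w. \<Sum>i<n. x i w *\<^sub>R y i) \<in> borel_measurable M"
proof -
  \<comment> \<open>Combinations of simple functions have finite range and are measurable; the
    general case is their pointwise limit.\<close>
  have "\<exists>s. (\<forall>k. simple_function M (s k)) \<and> (\<forall>w\<in>space M. (\<lambda>k. s k w) \<longlonglongrightarrow> x i w)" for i
    using borel_measurable_implies_sequence_metric[OF assms[of i], of 0] by blast
  then obtain s where s: "\<And>i k. simple_function M (s i k)"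
    "\<And>i w. w \<in> space M \<Longrightarrow> (\<lambda>k. s i k w) \<longlonglongrightarrow> x i w" by metis
  show ?thesis
  proof (rule borel_measurable_LIMSEQ_metric)
    show "(\<lambda>w. \<Sum>i<n. s i k w *\<^sub>R y i) \<in> borel_measurable M" for k
      by (intro borel_measurable_simple_function simple_function_sum simple_function_compose1[OF s(1)])
    show "(\<lambda>k. \<Sum>i<n. s i k w *\<^sub>R y i) \<longlonglongrightarrow> (\<Sum>i<n. x i w *\<^sub>R y i)" if "w \<in> space M" for w
      by (intro tendsto_sum tendsto_scaleR tendsto_const s(2) that)
  qed
qed

lemma represents_measurable: "represents M t f \<Longrightarrow> f \<in> borel_measurable M"
  unfolding represents_def by (auto intro: borel_measurable_sum_scaleR)

lemma norm_measurable:
  fixes f :: "'a \<Rightarrow> 'b::real_normed_vector"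
  shows "f \<in> borel_measurable M \<Longrightarrow> (\<lambda>w. norm (f w)) \<in> borel_measurable M"
  by (rule measurable_compose[of f M borel norm borel])
     (auto intro!: borel_measurable_continuous_onI continuous_intros)

lemma integrable_norm_sum_scaleR:
  fixes y :: "nat \<Rightarrow> 'b::real_normed_vector"
  assumes "\<And>i. integrable M (x i)"
  shows "integrable M (\<lambda>w. norm (\<Sum>i<n. x i w *\<^sub>R y i))"
    "(\<integral>w. norm (\<Sum>i<n. x i w *\<^sub>R y i) \<partial>M) \<le> (\<Sum>i<n. (\<integral>w. \<bar>x i w\<bar> \<partial>M) * norm (y i))"
proof -
  have int: "integrable M (\<lambda>w. \<Sum>i<n. \<bar>x i w\<bar> * norm (y i))" using assms by simp
  have le: "norm (\<Sum>i<n. x i w *\<^sub>R y i) \<le> (\<Sum>i<n. \<bar>x i w\<bar> * norm (y i))" for w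
    by (intro sum_norm_le) simp
  have meas: "(\<lambda>w. norm (\<Sum>i<n. x i w *\<^sub>R y i)) \<in> borel_measurable M"
    using assms by (intro norm_measurable borel_measurable_sum_scaleR) auto
  show i: "integrable M (\<lambda>w. norm (\<Sum>i<n. x i w *\<^sub>R y i))"
    by (rule Bochner_Integration.integrable_bound[OF int meas]) (auto intro: order_trans[OF le abs_ge_self])
  have "(\<integral>w. norm (\<Sum>i<n. x i w *\<^sub>R y i) \<partial>M) \<le> (\<integral>w. (\<Sum>i<n. \<bar>x i w\<bar> * norm (y i)) \<partial>M)"
    by (intro integral_mono i int le)
  also have "\<dots> = (\<Sum>i<n. (\<integral>w. \<bar>x i w\<bar> \<partial>M) * norm (y i))" using assms by simp
  finally show "(\<integral>w. norm (\<Sum>i<n. x i w *\<^sub>R y i) \<partial>M) \<le> (\<Sum>i<n. (\<integral>w. \<bar>x i w\<bar> \<partial>M) * norm (y i))" .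
qed

lemma represents_integrable: "represents M t f \<Longrightarrow> integrable M (\<lambda>w. norm (f w))"
  unfolding represents_def by (auto intro: integrable_norm_sum_scaleR)

text \<open>Bilinear forms need not be continuous, so the coordinates with respect to a Hamel basis
  separate tensors and no Hahn-Banach theorem is needed.\<close>

lemma bilinear_form_integral:
  fixes \<phi> :: "'b::real_normed_vector \<Rightarrow> real"
  assumes \<phi>: "linear \<phi>" and s: "s \<in> borel_measurable M" "\<And>w. \<bar>s w\<bar> \<le> 1"
  obtains A where "A \<in> bilinear_forms (L1 M) type_space"
    "\<And>f y. integrable M f \<Longrightarrow> A (L1_class M f) y = \<phi> y * (\<integral>w. s w * f w \<partial>M)"
proof -
  \<comment> \<open>The integral is defined on sets by choosing a member; on classes the choice does
    not matter, and \<open>\<bar>s w\<bar> \<le> 1\<close> keeps the product integrable.\<close>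
  define J where "J F = (\<integral>w. s w * (SOME f. f \<in> F) w \<partial>M)" for F :: "('a \<Rightarrow> real) set"
  have int: "integrable M (\<lambda>w. s w * f w)" if "integrable M f" for f
    by (rule Bochner_Integration.integrable_bound[OF that])
       (use that s in \<open>auto simp: abs_mult intro!: mult_left_le_one_le\<close>)
  have int': "integrable M (\<lambda>w. f w * s w)" if "integrable M f" for f
    using int[OF that] by (simp add: mult.commute)
  have J: "J (L1_class M f) = (\<integral>w. s w * f w \<partial>M)" if f: "integrable M f" for f
  proof -
    define g where "g = (SOME g. g \<in> L1_class M f)"
    have "g \<in> L1_class M f" unfolding g_def
      using someI[of "\<lambda>g. g \<in> L1_class M f", OF L1_class_self[OF f]] .
    then have g: "integrable M g" "AE w in M. f w = g w" by (auto simp: ae_rel_def)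
    have "(\<integral>w. s w * g w \<partial>M) = (\<integral>w. s w * f w \<partial>M)"
      using g f s(1) by (intro integral_cong_AE) auto
    then show ?thesis by (simp add: J_def g_def)
  qed
  have "(\<lambda>F y. \<phi> y * J F) \<in> bilinear_forms (L1 M) type_space"
    unfolding bilinear_forms_def
    by (auto elim!: L1_carrierE simp: L1_add_class L1_scale_class J int int' linear_add[OF \<phi>]
        linear_scale[OF \<phi>] algebra_simps)
  then show ?thesis using that[of "\<lambda>F y. \<phi> y * J F"] J by simp
qed

text \<open>Injectivity of the passage from functions to tensors. The \<open>y i\<close> are
  expanded in a finite basis \<open>B\<close> of their span, and each coefficient function
  \<open>F b\<close> is shown to vanish by testing the zero tensor with a form that produces the
  integral of \<open>\<bar>F b w\<bar>\<close>.\<close>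

lemma represents_zero:
  fixes f :: "'a \<Rightarrow> 'b::real_normed_vector"
  assumes "represents M (vzero (L1_tensor M)) f"
  shows "AE w in M. f w = 0"
proof -
  obtain n x and y :: "nat \<Rightarrow> 'b" where x: "\<And>i. integrable M (x i)"
    and t: "vzero (L1_tensor M) = tensor_sum (L1 M) type_space n (\<lambda>i. L1_class M (x i)) y"
    and f: "f = (\<lambda>w. \<Sum>i<n. x i w *\<^sub>R y i)"
    using assms unfolding represents_def by blast
  have zero: "(\<Sum>i<n. A (L1_class M (x i)) (y i)) = 0" if "A \<in> bilinear_forms (L1 M) type_space" for A
    using fun_cong[OF t, of A] that by (simp add: algebraic_tensor_product_def tensor_sum_eq)
  obtain B where B: "B \<subseteq> y ` {..<n}" "independent B" "y ` {..<n} \<subseteq> span B"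
    by (rule maximal_independent_subset)
  have finB: "finite B" using B(1) by (rule finite_subset) simp
  \<comment> \<open>A basis of the whole space makes each coordinate a linear functional defined
    everywhere, as a bilinear form requires; on the span of \<open>B\<close> the coordinates are
    unchanged.\<close>
  define E where "E = extend_basis B"
  have E: "independent E" "span E = UNIV" "B \<subseteq> E"
    using B(2) by (simp_all add: E_def independent_extend_basis span_extend_basis extend_basis_superset)
  define \<phi> where "\<phi> b v = representation E v b" for b v
  have lin: "linear (\<phi> b)" for b
    by (rule linearI) (simp_all add: \<phi>_def representation_add representation_scale E(1,2))
  have y: "y i = (\<Sum>b\<in>B. \<phi> b (y i) *\<^sub>R b)" if "i < n" for i
  proof -
    have "y i \<in> span B" using B(3) that by auto
    then show ?thesis
      unfolding \<phi>_def using representation_extend[OF E(1) _ E(3), of "y i"]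
        sum_representation_eq[OF B(2) _ finB, of "y i"] by simp
  qed
  define F where "F b w = (\<Sum>i<n. \<phi> b (y i) * x i w)" for b w
  have Fint: "integrable M (F b)" for b unfolding F_def using x by simp
  have "AE w in M. F b w = 0" for b
  proof -
    have [measurable]: "F b \<in> borel_measurable M" using Fint by simp
    have s: "(\<lambda>w. sgn (F b w)) \<in> borel_measurable M" by measurable
    obtain A where A: "A \<in> bilinear_forms (L1 M) type_space"
      and eq: "\<And>g v. integrable M g \<Longrightarrow> A (L1_class M g) v = \<phi> b v * (\<integral>w. sgn (F b w) * g w \<partial>M)"
      by (rule bilinear_form_integral[OF lin s]) (auto simp: sgn_if)
    have int: "integrable M (\<lambda>w. sgn (F b w) * x i w)" for i
      by (rule Bochner_Integration.integrable_bound[OF x[of i]])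
         (use x[of i] in \<open>auto simp: abs_mult sgn_if\<close>)
    have "(\<integral>w. \<bar>F b w\<bar> \<partial>M) = (\<integral>w. (\<Sum>i<n. \<phi> b (y i) * (sgn (F b w) * x i w)) \<partial>M)"
    proof (rule Bochner_Integration.integral_cong[OF refl])
      fix w
      have "\<bar>F b w\<bar> = sgn (F b w) * F b w" by (simp add: sgn_if)
      also have "\<dots> = (\<Sum>i<n. \<phi> b (y i) * (sgn (F b w) * x i w))"
        by (subst (2) F_def) (simp add: sum_distrib_left mult.left_commute)
      finally show "\<bar>F b w\<bar> = (\<Sum>i<n. \<phi> b (y i) * (sgn (F b w) * x i w))" .
    qed
    also have "\<dots> = (\<Sum>i<n. \<phi> b (y i) * (\<integral>w. sgn (F b w) * x i w \<partial>M))"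
      using int by (subst Bochner_Integration.integral_sum) auto
    also have "\<dots> = 0" using zero[OF A] by (simp add: eq x)
    finally show ?thesis
      using integral_nonneg_eq_0_iff_AE[of M "\<lambda>w. \<bar>F b w\<bar>"] Fint by simp
  qed
  then have "AE w in M. \<forall>b\<in>B. F b w = 0" using finB by (intro AE_finite_allI) auto
  then show ?thesis
  proof eventually_elim
    case (elim w)
    have "f w = (\<Sum>i<n. \<Sum>b\<in>B. (\<phi> b (y i) * x i w) *\<^sub>R b)"
      unfolding f
    proof (rule sum.cong[OF refl])
      fix i assume "i \<in> {..<n}"
      then have "x i w *\<^sub>R y i = x i w *\<^sub>R (\<Sum>b\<in>B. \<phi> b (y i) *\<^sub>R b)" using y[of i] by simp
      then show "x i w *\<^sub>R y i = (\<Sum>b\<in>B. (\<phi> b (y i) * x i w) *\<^sub>R b)"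
        by (simp add: scaleR_sum_right mult.commute)
    qed
    also have "\<dots> = (\<Sum>b\<in>B. F b w *\<^sub>R b)"
      by (subst sum.swap) (simp add: F_def scaleR_sum_left)
    finally show ?case using elim by simp
  qed
qed

lemma represents_unique:
  assumes "represents M t f" "represents M t g"
  shows "AE w in M. f w = g w"
proof -
  have "vadd (L1_tensor M) t (vscale (L1_tensor M) (-1) t) = vzero (L1_tensor M)"
    by (rule seminormed_space.add_minus[OF seminormed_L1_tensor represents_carrier[OF assms(1)]])
  then have "AE w in M. f w - g w = 0"
    using represents_diff[OF assms] by (intro represents_zero) simp
  then show ?thesis by simp
qed

section \<open>The two inequalities between the projective norm and the integral\<close>

text \<open>Each finite presentation of \<open>t\<close> yields a function equal to \<open>f\<close>
  almost everywhere, whose integrated norm is at most the cost of the presentation by the triangle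
  inequality.\<close>

lemma represents_norm_ge:
  assumes f: "represents M t f"
  shows "(\<integral>w. norm (f w) \<partial>M) \<le> vnorm (L1_tensor M) t"
  unfolding vnorm_algebraic_tensor[OF seminormed_L1 seminormed_type_space]
proof (rule projective_norm_ge[OF seminormed_L1 seminormed_type_space represents_carrier[OF f]])
  fix a assume "a \<in> rep_costs (L1 M) type_space t"
  then obtain n x y where a: "a = (\<Sum>i<n. vnorm (L1 M) (x i) * norm (y i))"
    and t: "t = tensor_sum (L1 M) type_space n x y" and x: "\<forall>i<n. x i \<in> carrier (L1 M)"
    by (auto simp: rep_costs_def)
  obtain x' where x': "\<And>i. integrable M (x' i)" "\<And>i. i < n \<Longrightarrow> x i = L1_class M (x' i)"
    using L1_carrier_choice[OF x] by blast
  define g where "g w = (\<Sum>i<n. x' i w *\<^sub>R y i)" for w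
  have "t = tensor_sum (L1 M) type_space n (\<lambda>i. L1_class M (x' i)) y"
    unfolding t tensor_sum_eq by (intro restrict_ext sum.cong) (auto simp: x'(2))
  then have g: "represents M t g"
    using x'(1) unfolding represents_def g_def[abs_def] by blast
  have "(\<integral>w. norm (f w) \<partial>M) = (\<integral>w. norm (g w) \<partial>M)"
  proof (rule integral_cong_AE)
    show "AE w in M. norm (f w) = norm (g w)" using represents_unique[OF f g] by eventually_elim simp
  qed (use f g in \<open>auto intro: norm_measurable represents_measurable\<close>)
  also have "\<dots> \<le> (\<Sum>i<n. (\<integral>w. \<bar>x' i w\<bar> \<partial>M) * norm (y i))"
    unfolding g_def by (rule integrable_norm_sum_scaleR(2)[OF x'(1)])
  also have "\<dots> = a" unfolding a by (intro sum.cong) (auto simp: x' L1_norm_class)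
  finally show "(\<integral>w. norm (f w) \<partial>M) \<le> a" .
qed

text \<open>Arbitrary finite index sets are allowed because the sum will run over the values of a
  simple function.\<close>

lemma projective_norm_finite_sum_le:
  fixes y :: "'i \<Rightarrow> 'b::real_normed_vector"
  assumes I: "finite I" and x: "\<And>i. i \<in> I \<Longrightarrow> integrable M (x i)"
    and u: "u = (\<lambda>A\<in>bilinear_forms (L1 M) type_space. \<Sum>i\<in>I. A (L1_class M (x i)) (y i))"
  shows "vnorm (L1_tensor M) u \<le> (\<Sum>i\<in>I. (\<integral>w. \<bar>x i w\<bar> \<partial>M) * norm (y i))"
proof -
  obtain h where h: "bij_betw h {..<card I} I"
    using ex_bij_betw_nat_finite[OF I] by (auto simp: lessThan_atLeast0)
  have hI: "h i \<in> I" if "i < card I" for i using h that by (auto simp: bij_betw_def)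
  have "u = tensor_sum (L1 M) type_space (card I) (\<lambda>i. L1_class M (x (h i))) (\<lambda>i. y (h i))"
    unfolding u tensor_sum_eq by (intro restrict_ext sum.reindex_bij_betw[OF h, symmetric])
  moreover have "(\<Sum>i\<in>I. (\<integral>w. \<bar>x i w\<bar> \<partial>M) * norm (y i)) =
      (\<Sum>i<card I. vnorm (L1 M) (L1_class M (x (h i))) * vnorm type_space (y (h i)))"
    by (subst sum.reindex_bij_betw[OF h, symmetric], rule sum.cong) (auto simp: L1_norm_class x hI)
  moreover have "\<forall>i<card I. L1_class M (x (h i)) \<in> carrier (L1 M) \<and> y (h i) \<in> carrier type_space"
    using hI x by (auto intro: L1_carrierI)
  ultimately have "(\<Sum>i\<in>I. (\<integral>w. \<bar>x i w\<bar> \<partial>M) * norm (y i)) \<in> rep_costs (L1 M) type_space u"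
    using rep_costsI[of "card I" "\<lambda>i. L1_class M (x (h i))" "L1 M" "\<lambda>i. y (h i)" type_space]
    by simp
  then show ?thesis
    unfolding vnorm_algebraic_tensor[OF seminormed_L1 seminormed_type_space]
    by (rule projective_norm_le[OF seminormed_L1 seminormed_type_space])
qed

text \<open>Read off from the definition of the integral, by which simple functions of finite
  support converge to \<open>f\<close> in mean.\<close>

lemma integrable_simple_approx:
  fixes f :: "'a \<Rightarrow> real"
  assumes "integrable M f" "0 < d"
  obtains s where "simple_function M s" "emeasure M {w \<in> space M. s w \<noteq> 0} < \<infinity>"
    "integrable M s" "(\<integral>w. \<bar>f w - s w\<bar> \<partial>M) < d"
proof -
  obtain v where "has_bochner_integral M f v" using assms(1) by (auto simp: integrable.simps)
  then have "\<exists>S. (\<forall>i. Bochner_Integration.simple_bochner_integrable M (S i)) \<and>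
      (\<lambda>i. \<integral>\<^sup>+w. norm (f w - S i w) \<partial>M) \<longlonglongrightarrow> 0"
  proof cases
    case (1 S)
    then show ?thesis by blast
  qed
  then obtain S where S: "\<And>i. Bochner_Integration.simple_bochner_integrable M (S i)"
    "(\<lambda>i. \<integral>\<^sup>+w. norm (f w - S i w) \<partial>M) \<longlonglongrightarrow> 0" by blast
  have "eventually (\<lambda>i. (\<integral>\<^sup>+w. norm (f w - S i w) \<partial>M) < ennreal d) sequentially"
    using order_tendstoD(2)[OF S(2), of "ennreal d"] assms(2) by simp
  then obtain i where i: "(\<integral>\<^sup>+w. norm (f w - S i w) \<partial>M) < ennreal d"
    by (auto simp: eventually_sequentially)
  have s: "integrable M (S i)"
    using has_bochner_integral_simple_bochner_integrable[OF S(1)] by (rule integrable.intros)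
  have "(\<integral>\<^sup>+w. norm (f w - S i w) \<partial>M) = ennreal (\<integral>w. norm (f w - S i w) \<partial>M)"
    using assms(1) s by (intro nn_integral_eq_integral) auto
  with i assms(2) have "(\<integral>w. \<bar>f w - S i w\<bar> \<partial>M) < d" by (simp add: ennreal_less_iff)
  moreover have "simple_function M (S i)" "emeasure M {w \<in> space M. S i w \<noteq> 0} < \<infinity>"
    using S(1)[of i] by (cases, simp add: less_top)+
  ultimately show ?thesis using s that by blast
qed

text \<open>Joining \<open>n\<close> simple functions into one, padded by zeros, gives a common
  partition for all of them.\<close>

lemma simple_function_nat_tuple:
  assumes "\<And>i. simple_function M (s i)"
  shows "simple_function M (\<lambda>w i. if i < (n::nat) then s i w else 0)"
proof (induction n)
  case (Suc n)
  have "simple_function M (\<lambda>w. (\<lambda>i. if i < n then s i w else 0)(n := s n w))"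
    by (rule simple_function_compose2[OF Suc assms, where h = "\<lambda>a b. a(n := b)"])
  also have "(\<lambda>w. (\<lambda>i. if i < n then s i w else 0)(n := s n w)) =
      (\<lambda>w i. if i < Suc n then s i w else 0)"
    by (auto simp: fun_eq_iff)
  finally show ?case .
qed simp

lemma simple_tensor_norm_le:
  fixes y :: "nat \<Rightarrow> 'b::real_normed_vector"
  assumes s: "\<And>i. simple_function M (s i)"
      "\<And>i. emeasure M {w \<in> space M. s i w \<noteq> 0} < \<infinity>" "\<And>i. integrable M (s i)"
  shows "vnorm (L1_tensor M) (tensor_sum (L1 M) type_space n (\<lambda>i. L1_class M (s i)) y) \<le>
    (\<integral>w. norm (\<Sum>i<n. s i w *\<^sub>R y i) \<partial>M)"
proof -
  define F where "F w i = (if i < n then s i w else 0)" for w i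
  have simple: "simple_function M F"
    unfolding F_def[abs_def]
    using s(1) by (rule simple_function_nat_tuple)
  \<comment> \<open>The zero tuple is removed: its level set may have infinite measure, and it
    contributes nothing.\<close>
  define V where "V = F ` space M - {\<lambda>i. 0}"
  have finV: "finite V" using simple_functionD(1)[OF simple] by (simp add: V_def)
  define S where "S v = F -` {v} \<inter> space M" for v
  have S: "S v \<in> sets M" for v unfolding S_def by (rule simple_functionD(2)[OF simple])
  have Sint: "integrable M (indicator (S v) :: 'a \<Rightarrow> real)" if "v \<in> V" for v
  proof -
    have "v \<noteq> (\<lambda>i. 0)" using that by (simp add: V_def)
    then obtain i where i: "v i \<noteq> 0" by auto
    have "emeasure M (S v) \<le> emeasure M {w \<in> space M. s i w \<noteq> 0}"
      using i borel_measurable_simple_function[OF s(1)[of i]]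
      by (intro emeasure_mono) (auto simp: S_def F_def split: if_splits)
    also note s(2)[of i]
    finally show ?thesis using S by simp
  qed
  have sel: "(\<Sum>v\<in>V. h v * indicator (S v) w) = (if F w = (\<lambda>i. 0) then 0 else h (F w))"
    if "w \<in> space M" for h :: "_ \<Rightarrow> real" and w
  proof -
    have "(\<Sum>v\<in>V. h v * indicator (S v) w) = (\<Sum>v\<in>V. if v = F w then h v else 0)"
      using that by (intro sum.cong) (auto simp: S_def)
    then show ?thesis using that finV by (auto simp: V_def sum.delta)
  qed
  have s_eq: "s i w = (\<Sum>v\<in>V. v i * indicator (S v) w)" if "i < n" "w \<in> space M" for i w
    using sel[OF that(2), of "\<lambda>v. v i"] that(1) by (auto simp: F_def fun_eq_iff split: if_splits)
  have "tensor_sum (L1 M) type_space n (\<lambda>i. L1_class M (s i)) y =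
    (\<lambda>A\<in>bilinear_forms (L1 M) type_space.
      \<Sum>v\<in>V. A (L1_class M (indicator (S v))) (\<Sum>i<n. v i *\<^sub>R y i))"
    unfolding tensor_sum_eq
  proof (rule restrict_ext)
    fix A :: "('a \<Rightarrow> real) set \<Rightarrow> 'b \<Rightarrow> real" assume A: "A \<in> bilinear_forms (L1 M) type_space"
    have "A (L1_class M (s i)) (y i) = (\<Sum>v\<in>V. v i * A (L1_class M (indicator (S v))) (y i))"
      if "i < n" for i
    proof -
      have "L1_class M (s i) = L1_class M (\<lambda>w. \<Sum>v\<in>V. v i * indicator (S v) w)"
        using s(3) Sint s_eq[OF that] by (intro L1_class_eqI) auto
      then show ?thesis using Sint by (simp add: bilinear_L1_sum[OF A] bilinear_L1_scale[OF A])
    qed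
    then have "(\<Sum>i<n. A (L1_class M (s i)) (y i)) =
        (\<Sum>i<n. \<Sum>v\<in>V. v i * A (L1_class M (indicator (S v))) (y i))" by simp
    also have "\<dots> = (\<Sum>v\<in>V. A (L1_class M (indicator (S v))) (\<Sum>i<n. v i *\<^sub>R y i))"
      by (subst sum.swap) (simp add: bilinear_sum_right[OF A Sint])
    finally show "(\<Sum>i<n. A (L1_class M (s i)) (y i)) =
      (\<Sum>v\<in>V. A (L1_class M (indicator (S v))) (\<Sum>i<n. v i *\<^sub>R y i))" .
  qed
  from projective_norm_finite_sum_le[OF finV _ this] Sint
  have "vnorm (L1_tensor M) (tensor_sum (L1 M) type_space n (\<lambda>i. L1_class M (s i)) y) \<le>
      (\<Sum>v\<in>V. (\<integral>w. \<bar>indicator (S v) w\<bar> \<partial>M) * norm (\<Sum>i<n. v i *\<^sub>R y i))" by blast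
  also have "\<dots> = (\<integral>w. (\<Sum>v\<in>V. norm (\<Sum>i<n. v i *\<^sub>R y i) * indicator (S v) w) \<partial>M)"
    using Sint by (simp add: mult.commute)
  also have "\<dots> = (\<integral>w. norm (\<Sum>i<n. s i w *\<^sub>R y i) \<partial>M)"
  proof (rule Bochner_Integration.integral_cong[OF refl])
    fix w assume w: "w \<in> space M"
    have "(\<Sum>i<n. s i w *\<^sub>R y i) = (\<Sum>i<n. F w i *\<^sub>R y i)" by (simp add: F_def)
    then show "(\<Sum>v\<in>V. norm (\<Sum>i<n. v i *\<^sub>R y i) * indicator (S v) w) = norm (\<Sum>i<n. s i w *\<^sub>R y i)"
      by (simp add: sel[OF w])
  qed
  finally show ?thesis .
qed

text \<open>The coefficients are approximated in mean by simple functions, for which the bound is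
  known. The error \<open>z\<close> enters twice, in the tensor norm and in the integral, each time
  with at most \<open>r / 2\<close>.\<close>

lemma represents_norm_le:
  fixes f :: "'a \<Rightarrow> 'b::real_normed_vector"
  assumes f: "represents M t f"
  shows "vnorm (L1_tensor M) t \<le> (\<integral>w. norm (f w) \<partial>M)"
proof (rule field_le_epsilon)
  fix r :: real assume r: "0 < r"
  obtain n x and y :: "nat \<Rightarrow> 'b" where x: "\<And>i. integrable M (x i)"
    and t: "t = tensor_sum (L1 M) type_space n (\<lambda>i. L1_class M (x i)) y"
    and f_eq: "f = (\<lambda>w. \<Sum>i<n. x i w *\<^sub>R y i)"
    using f unfolding represents_def by blast
  define K where "K = (\<Sum>i<n. norm (y i))"
  have K: "0 \<le> K" by (simp add: K_def sum_nonneg)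
  \<comment> \<open>Adding 1 to \<open>K\<close> avoids division by 0 when all \<open>y i\<close>
    vanish.\<close>
  define d where "d = r / (2 * (K + 1))"
  have d: "0 < d" using r K by (simp add: d_def)
  have "\<exists>s. simple_function M s \<and> emeasure M {w \<in> space M. s w \<noteq> 0} < \<infinity> \<and> integrable M s \<and>
      (\<integral>w. \<bar>x i w - s w\<bar> \<partial>M) < d" for i
    by (rule integrable_simple_approx[OF x[of i] d]) blast
  then have "\<exists>s. \<forall>i. simple_function M (s i) \<and> emeasure M {w \<in> space M. s i w \<noteq> 0} < \<infinity> \<and>
      integrable M (s i) \<and> (\<integral>w. \<bar>x i w - s i w\<bar> \<partial>M) < d"
    by (intro choice allI)
  then obtain s where s: "\<And>i. simple_function M (s i)"
      "\<And>i. emeasure M {w \<in> space M. s i w \<noteq> 0} < \<infinity>" "\<And>i. integrable M (s i)"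
    and xs: "\<And>i. (\<integral>w. \<bar>x i w - s i w\<bar> \<partial>M) < d" by blast
  define z where "z i w = x i w - s i w" for i w
  have z: "integrable M (z i)" for i unfolding z_def using x s by simp
  have cost: "(\<Sum>i<n. (\<integral>w. \<bar>z i w\<bar> \<partial>M) * norm (y i)) \<le> r / 2"
  proof -
    have "(\<Sum>i<n. (\<integral>w. \<bar>z i w\<bar> \<partial>M) * norm (y i)) \<le> (\<Sum>i<n. d * norm (y i))"
      unfolding z_def using xs by (intro sum_mono mult_right_mono) (auto intro: less_imp_le)
    also have "\<dots> = d * K" by (simp add: K_def sum_distrib_left)
    also have "\<dots> \<le> d * (K + 1)" using d by simp
    also have "\<dots> = r / 2" using K by (simp add: d_def field_simps)
    finally show ?thesis .
  qed
  define ts where "ts = tensor_sum (L1 M) type_space n (\<lambda>i. L1_class M (s i)) y"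
  define tz where "tz = tensor_sum (L1 M) type_space n (\<lambda>i. L1_class M (z i)) y"
  have ts: "represents M ts (\<lambda>w. \<Sum>i<n. s i w *\<^sub>R y i)"
    unfolding represents_def ts_def using s(3) by blast
  have tz: "represents M tz (\<lambda>w. \<Sum>i<n. z i w *\<^sub>R y i)"
    unfolding represents_def tz_def using z by blast
  have split: "A (L1_class M (x i)) v = A (L1_class M (s i)) v + A (L1_class M (z i)) v"
    if "A \<in> bilinear_forms (L1 M) type_space" for A i and v :: 'b
    using bilinear_L1_add[OF that s(3)[of i] z[of i]] by (simp add: z_def)
  have "t = vadd (L1_tensor M) ts tz"
    unfolding t ts_def tz_def tensor_sum_eq algebraic_tensor_product_def nspace.simps
  proof (rule restrict_ext)
    fix A :: "('a \<Rightarrow> real) set \<Rightarrow> 'b \<Rightarrow> real" assume A: "A \<in> bilinear_forms (L1 M) type_space"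
    show "(\<Sum>i<n. A (L1_class M (x i)) (y i)) =
      (\<lambda>A\<in>bilinear_forms (L1 M) type_space. \<Sum>i<n. A (L1_class M (s i)) (y i)) A +
      (\<lambda>A\<in>bilinear_forms (L1 M) type_space. \<Sum>i<n. A (L1_class M (z i)) (y i)) A"
      using A by (simp add: sum.distrib split[OF A])
  qed
  then have "vnorm (L1_tensor M) t \<le> vnorm (L1_tensor M) ts + vnorm (L1_tensor M) tz"
    using seminormed_space.norm_triangle[OF seminormed_L1_tensor
        represents_carrier[OF ts] represents_carrier[OF tz]] by simp
  moreover have "vnorm (L1_tensor M) tz \<le> r / 2"
    by (rule order_trans[OF projective_norm_finite_sum_le[OF finite_lessThan z] cost])
       (simp add: tz_def tensor_sum_eq)
  moreover have "vnorm (L1_tensor M) ts \<le> (\<integral>w. norm (\<Sum>i<n. s i w *\<^sub>R y i) \<partial>M)"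
    unfolding ts_def by (rule simple_tensor_norm_le[OF s])
  moreover have "(\<integral>w. norm (\<Sum>i<n. s i w *\<^sub>R y i) \<partial>M) \<le> (\<integral>w. norm (f w) \<partial>M) + r / 2"
  proof -
    have "norm (\<Sum>i<n. s i w *\<^sub>R y i) \<le> norm (f w) + norm (\<Sum>i<n. z i w *\<^sub>R y i)" for w
    proof -
      have "(\<Sum>i<n. s i w *\<^sub>R y i) = f w - (\<Sum>i<n. z i w *\<^sub>R y i)"
        by (simp add: f_eq z_def scaleR_left_diff_distrib sum_subtractf)
      then show ?thesis by (simp add: norm_triangle_ineq4)
    qed
    then have "(\<integral>w. norm (\<Sum>i<n. s i w *\<^sub>R y i) \<partial>M) \<le>
        (\<integral>w. norm (f w) + norm (\<Sum>i<n. z i w *\<^sub>R y i) \<partial>M)"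
      using represents_integrable[OF f]
      by (intro integral_mono Bochner_Integration.integrable_add integrable_norm_sum_scaleR s z)
    also have "\<dots> = (\<integral>w. norm (f w) \<partial>M) + (\<integral>w. norm (\<Sum>i<n. z i w *\<^sub>R y i) \<partial>M)"
      using represents_integrable[OF f]
      by (intro Bochner_Integration.integral_add integrable_norm_sum_scaleR z)
    also have "\<dots> \<le> (\<integral>w. norm (f w) \<partial>M) + r / 2"
      using integrable_norm_sum_scaleR(2)[of M z, OF z, where n = n and y = y] cost by simp
    finally show ?thesis .
  qed
  ultimately show "vnorm (L1_tensor M) t \<le> (\<integral>w. norm (f w) \<partial>M) + r" by linarith
qed

lemma represents_norm:
  "represents M t f \<Longrightarrow> vnorm (L1_tensor M) t = (\<integral>w. norm (f w) \<partial>M)"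
  by (intro order_antisym represents_norm_le represents_norm_ge)

lemma represents_vdist:
  assumes "represents M t f" "represents M u g"
  shows "vdist (L1_tensor M) t u = (\<integral>w. norm (f w - g w) \<partial>M)"
  unfolding vdist_def by (rule represents_norm[OF represents_diff[OF assms]])

section \<open>Attaining the projective norm\<close>

text \<open>The tail of the vector series is bounded by the tail of the coefficients, whose sum is
  known because the total mass is \<open>norm y\<close>. This bound drives the final convergence
  estimate.\<close>

lemma gen_reps_tail:
  assumes l: "l \<in> gen_reps e y" and e: "\<And>i. norm (e i) \<le> 1"
  shows "norm ((\<Sum>i<n. l i *\<^sub>R e i) - y) \<le> norm y - (\<Sum>i<n. l i)"
proof -
  have nonneg: "0 \<le> l i" for i using l by (simp add: gen_reps_def)
  have s1: "(\<lambda>i. l (i + n) *\<^sub>R e (i + n)) sums (y - (\<Sum>i<n. l i *\<^sub>R e i))"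
    using l by (intro sums_split_initial_segment) (simp add: gen_reps_def)
  have s2: "(\<lambda>i. l (i + n)) sums (norm y - (\<Sum>i<n. l i))"
    by (intro sums_split_initial_segment gen_reps_sums_norm[OF l e])
  have "norm (l (i + n) *\<^sub>R e (i + n)) \<le> l (i + n)" for i
    using mult_left_mono[OF e[of "i + n"] nonneg[of "i + n"]] nonneg[of "i + n"] by simp
  then have "norm (\<Sum>i. l (i + n) *\<^sub>R e (i + n)) \<le> (\<Sum>i. l (i + n))"
    by (intro norm_suminf_le sums_summable[OF s2])
  then show ?thesis
    by (simp add: norm_minus_commute flip: sums_unique[OF s1] sums_unique[OF s2])
qed

section \<open>Elements of the completion as limits of functions\<close>

lemma summable_increments_limit:
  fixes g :: "nat \<Rightarrow> 'b::banach"
  assumes "summable (\<lambda>k. norm (g (Suc k) - g k))"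
  shows "g \<longlonglongrightarrow> lim g" "norm (g k - lim g) \<le> (\<Sum>j. norm (g (Suc (j + k)) - g (j + k)))"
proof -
  define L where "L = g 0 + (\<Sum>k. g (Suc k) - g k)"
  have sums: "(\<lambda>k. g (Suc k) - g k) sums (L - g 0)"
    unfolding L_def using summable_sums[OF summable_norm_cancel[OF assms]] by simp
  then have "(\<lambda>k. g k - g 0) \<longlonglongrightarrow> L - g 0"
    by (simp add: sums_def sum_lessThan_telescope)
  then have lim: "g \<longlonglongrightarrow> L" using tendsto_add[OF _ tendsto_const[of "g 0"]] by fastforce
  then have L: "lim g = L" by (rule limI)
  with lim show "g \<longlonglongrightarrow> lim g" by simp
  have s: "(\<lambda>j. g (Suc (j + k)) - g (j + k)) sums (L - g 0 - (\<Sum>i<k. g (Suc i) - g i))"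
    using sums_split_initial_segment[OF sums, of k] by simp
  have "norm (\<Sum>j. g (Suc (j + k)) - g (j + k)) \<le> (\<Sum>j. norm (g (Suc (j + k)) - g (j + k)))"
    using summable_ignore_initial_segment[OF assms, of k] by (intro summable_norm) simp
  then show "norm (g k - lim g) \<le> (\<Sum>j. norm (g (Suc (j + k)) - g (j + k)))"
    by (simp add: L norm_minus_commute sum_lessThan_telescope flip: sums_unique[OF s])
qed

text \<open>The Riesz-Fischer argument: the integrals of the increments are summable, so the
  increments are summable almost everywhere. \<open>h k\<close> is the tail sum of increments, an
  integrable majorant of the error, so that only real functions are integrated.\<close>

lemma L1_fast_Cauchy_limit:
  fixes g :: "nat \<Rightarrow> 'a \<Rightarrow> 'b::banach"
  assumes g: "\<And>k. g k \<in> borel_measurable M"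
    and int: "\<And>k. integrable M (\<lambda>w. norm (g (Suc k) w - g k w))"
    and le: "\<And>k. (\<integral>w. norm (g (Suc k) w - g k w) \<partial>M) \<le> (1/2)^k"
  obtains f h where "f \<in> borel_measurable M" "\<And>k. integrable M (h k)"
    "(\<lambda>k. \<integral>w. h k w \<partial>M) \<longlonglongrightarrow> 0" "AE w in M. \<forall>k. norm (g k w - f w) \<le> h k w"
proof -
  define d where "d k w = norm (g (Suc k) w - g k w)" for k w
  have dint: "integrable M (d k)" for k unfolding d_def using int .
  have [measurable]: "d k \<in> borel_measurable M" for k using dint by simp
  have d0: "0 \<le> d k w" for k w by (simp add: d_def)
  define a where "a k = (\<integral>w. d k w \<partial>M)" for k
  have a0: "0 \<le> a k" for k unfolding a_def by (simp add: d0)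
  have ale: "a k \<le> (1/2)^k" for k unfolding a_def d_def by (rule le)
  have asum: "summable a"
    by (rule summable_comparison_test'[of "\<lambda>k. (1/2)^k"]) (use a0 ale in \<open>auto simp: summable_geometric\<close>)
  define T where "T w = (\<Sum>k. ennreal (d k w))" for w
  have [measurable]: "T \<in> borel_measurable M" unfolding T_def by measurable
  have "(\<integral>\<^sup>+w. T w \<partial>M) = (\<Sum>k. \<integral>\<^sup>+w. ennreal (d k w) \<partial>M)"
    unfolding T_def by (rule nn_integral_suminf) measurable
  also have "\<dots> = (\<Sum>k. ennreal (a k))"
    unfolding a_def using dint d0 by (simp add: nn_integral_eq_integral)
  also have "\<dots> = ennreal (\<Sum>k. a k)" by (rule suminf_ennreal2[OF a0 asum])
  finally have "(\<integral>\<^sup>+w. T w \<partial>M) \<noteq> \<infinity>" by simp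
  then have fin: "AE w in M. T w \<noteq> \<infinity>" by (intro nn_integral_noteq_infinite) auto
  have sm: "summable (\<lambda>k. d k w)" if "T w \<noteq> \<infinity>" for w
    using that d0 unfolding T_def by (intro summable_suminf_not_top) auto
  \<comment> \<open>With the value 0 on the exceptional set, \<open>f\<close> is a limit at every
    point of functions modified in the same way, hence measurable.\<close>
  define f where "f w = (if T w = \<infinity> then 0 else lim (\<lambda>k. g k w))" for w
  define h where "h k w = (\<Sum>j. d (j + k) w)" for k w
  have lims: "(\<lambda>k. g k w) \<longlonglongrightarrow> f w" "norm (g k w - f w) \<le> h k w" if "T w \<noteq> \<infinity>" for k w
    using summable_increments_limit[of "\<lambda>k. g k w"] sm[OF that] that
    by (auto simp: f_def h_def d_def)
  have "f \<in> borel_measurable M"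
  proof (rule borel_measurable_LIMSEQ_metric)
    show "(\<lambda>w. if T w = \<infinity> then 0 else g k w) \<in> borel_measurable M" for k
      using g by (intro measurable_If) auto
    show "(\<lambda>k. if T w = \<infinity> then 0 else g k w) \<longlonglongrightarrow> f w" for w
      using lims(1)[of w] by (cases "T w = \<infinity>") (auto simp: f_def)
  qed
  moreover have "integrable M (h k) \<and> (\<integral>w. h k w \<partial>M) = (\<Sum>j. a j) - (\<Sum>j<k. a j)" for k
  proof -
    have sAE: "AE w in M. summable (\<lambda>j. norm (d (j + k) w))"
      using fin
    proof eventually_elim
      case (elim w)
      from summable_ignore_initial_segment[OF sm[OF this], of k] show ?case by (simp add: d0)
    qed
    have asumk: "summable (\<lambda>j. \<integral>w. norm (d (j + k) w) \<partial>M)"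
      using summable_ignore_initial_segment[OF asum, of k] d0 by (simp add: a_def)
    have "(\<integral>w. h k w \<partial>M) = (\<Sum>j. a (j + k))"
      unfolding h_def a_def by (rule integral_suminf[OF dint sAE asumk])
    moreover have "integrable M (h k)"
      unfolding h_def by (rule integrable_suminf[OF dint sAE asumk])
    ultimately show ?thesis using suminf_minus_initial_segment[OF asum, of k] by simp
  qed
  moreover have "(\<lambda>k. (\<Sum>j. a j) - (\<Sum>j<k. a j)) \<longlonglongrightarrow> (\<Sum>j. a j) - (\<Sum>j. a j)"
    by (intro tendsto_diff tendsto_const summable_LIMSEQ asum)
  moreover have "AE w in M. \<forall>k. norm (g k w - f w) \<le> h k w"
    using fin by eventually_elim (use lims in auto)
  ultimately show ?thesis by (intro that[of f h]) auto
qed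

lemma (in seminormed_space) completion_vdist:
  assumes s: "s \<in> cauchy_seqs V" and t: "t \<in> cauchy_seqs V"
  shows "(\<lambda>n. vdist V (s n) (t n)) \<longlonglongrightarrow>
    vdist (nspace_completion V) (null_rel V `` {s}) (null_rel V `` {t})"
  using completion_norm_class[OF cauchy_seqs_add[OF s cauchy_seqs_scale[OF t, of "-1"]]]
  by (simp add: vdist_def completion_scale_class[OF t]
      completion_add_class[OF s cauchy_seqs_scale[OF t]])

lemma cauchy_seqs_fast_subseq:
  assumes "s \<in> cauchy_seqs V"
  obtains r where "strict_mono r" "\<And>k. vdist V (s (r (Suc k))) (s (r k)) \<le> (1/2)^k"
proof -
  have "\<exists>N. \<forall>m\<ge>N. \<forall>n\<ge>N. vdist V (s m) (s n) < (1/2)^k" for k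
    using assms by (simp add: cauchy_seqs_def)
  then obtain N where N: "\<And>k m n. N k \<le> m \<Longrightarrow> N k \<le> n \<Longrightarrow> vdist V (s m) (s n) < (1/2)^k"
    by metis
  \<comment> \<open>The sum dominates \<open>N k\<close>, and the summand \<open>k\<close> makes the
    sequence strictly increasing.\<close>
  define r where "r k = (\<Sum>i\<le>k. N i) + k" for k
  have "strict_mono r" by (rule strict_monoI_Suc) (simp add: r_def)
  moreover have "N k \<le> r k" for k
    using member_le_sum[of k "{..k}" N] by (simp add: r_def)
  moreover have "r k \<le> r (Suc k)" for k by (simp add: r_def)
  ultimately show ?thesis
    using N by (intro that[of r]) (meson less_imp_le order_trans)+
qed

lemma represents_tensor:
  assumes "integrable M x"
  shows "represents M (tensor (L1 M) type_space (L1_class M x) v) (\<lambda>w. x w *\<^sub>R v)"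
  unfolding represents_def using assms
  by (intro exI[of _ 1] exI[of _ "\<lambda>_. x"] exI[of _ "\<lambda>_. v"])
     (auto simp: tensor_sum_eq tensor_def)

lemma represents_vsum:
  assumes x: "\<And>i. integrable M (x i)"
  shows "represents M
    (vsum (L1_tensor M) (\<lambda>i. tensor (L1 M) type_space (L1_class M (x i)) (e i)) n)
    (\<lambda>w. \<Sum>i<n. x i w *\<^sub>R e i)"
proof (induction n)
  case 0
  have "represents M (tensor_sum (L1 M) type_space 0 (\<lambda>i. L1_class M (x i)) e)
      (\<lambda>w. \<Sum>i<0. x i w *\<^sub>R e i)"
    unfolding represents_def using x by blast
  moreover have "tensor_sum (L1 M) type_space 0 (\<lambda>i. L1_class M (x i)) e = vzero (L1_tensor M)"
    unfolding tensor_sum_eq by (simp add: algebraic_tensor_product_def)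
  ultimately show ?case by simp
next
  case (Suc n)
  then show ?case using represents_add[OF Suc represents_tensor[OF x]] by simp
qed

lemma vsum_proj_tensor:
  assumes x: "\<And>i. integrable M (x i)"
  shows "vsum (projective_tensor_product (L1 M) type_space)
      (\<lambda>i. proj_tensor (L1 M) type_space (L1_class M (x i)) (e i)) n =
    null_rel (L1_tensor M) `` {\<lambda>_. vsum (L1_tensor M)
      (\<lambda>i. tensor (L1 M) type_space (L1_class M (x i)) (e i)) n}"
proof (induction n)
  case 0
  show ?case
    by (simp add: projective_tensor_product_def nspace_completion_def)
next
  case (Suc n)
  note const = seminormed_space.cauchy_seqs_const[OF seminormed_L1_tensor]
  show ?case
    using seminormed_space.completion_add_class[OF seminormed_L1_tensor
        const[OF represents_carrier[OF represents_vsum[OF x]]]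
        const[OF represents_carrier[OF represents_tensor[OF x]]]] Suc
    by (simp add: proj_tensor_def completion_embed_def projective_tensor_product_def)
qed

text \<open>The part of the identification with Bochner functions that is needed: along a
  subsequence, functions representing the approximating tensors converge to \<open>f\<close> in
  mean, with explicit majorants \<open>h k\<close>.\<close>

lemma projective_tensor_limit_function:
  assumes "u \<in> carrier (projective_tensor_product (L1 M) (type_space :: 'b::banach nspace))"
  obtains s r g and f :: "'a \<Rightarrow> 'b::banach" and h where
    "s \<in> cauchy_seqs (L1_tensor M)" "u = null_rel (L1_tensor M) `` {s}" "strict_mono r"
    "\<And>k. represents M (s (r k)) (g k)"
    "f \<in> borel_measurable M" "integrable M (\<lambda>w. norm (f w))" "\<And>k. integrable M (h k)"
    "(\<lambda>k. \<integral>w. h k w \<partial>M) \<longlonglongrightarrow> 0" "AE w in M. \<forall>k. norm (g k w - f w) \<le> h k w"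
proof -
  obtain s :: "nat \<Rightarrow> (('a \<Rightarrow> real) set, 'b) tensor" where s: "s \<in> cauchy_seqs (L1_tensor M)" "u = null_rel (L1_tensor M) `` {s}"
    using seminormed_space.completion_carrierE[OF seminormed_L1_tensor] assms
    unfolding projective_tensor_product_def by metis
  have "\<exists>F. represents M (s k) F" for k
  proof -
    have "s k \<in> carrier (L1_tensor M)" using s(1) by (simp add: cauchy_seqs_def)
    then show ?thesis by (rule carrier_represents) blast
  qed
  then obtain F where F: "\<And>k. represents M (s k) (F k)" by metis
  obtain r where r: "strict_mono r" "\<And>k. vdist (L1_tensor M) (s (r (Suc k))) (s (r k)) \<le> (1/2)^k"
    by (rule cauchy_seqs_fast_subseq[OF s(1)]) blast
  define g where "g k = F (r k)" for k
  have g: "represents M (s (r k)) (g k)" for k unfolding g_def by (rule F)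
  obtain f h where fh: "f \<in> borel_measurable M" "\<And>k. integrable M (h k)"
    "(\<lambda>k. \<integral>w. h k w \<partial>M) \<longlonglongrightarrow> 0" "AE w in M. \<forall>k. norm (g k w - f w) \<le> h k w"
  proof (rule L1_fast_Cauchy_limit[of g M])
    show "g k \<in> borel_measurable M" for k by (rule represents_measurable[OF g])
    show "integrable M (\<lambda>w. norm (g (Suc k) w - g k w))" for k
      by (rule represents_integrable[OF represents_diff[OF g g]])
    show "(\<integral>w. norm (g (Suc k) w - g k w) \<partial>M) \<le> (1/2)^k" for k
      using r(2)[of k] by (simp add: represents_vdist[OF g g])
  qed blast
  have "integrable M (\<lambda>w. norm (f w))"
  proof (rule Bochner_Integration.integrable_bound)
    show "integrable M (\<lambda>w. norm (g 0 w) + h 0 w)"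
      using represents_integrable[OF g] fh(2) by simp
    show "AE w in M. norm (norm (f w)) \<le> norm (norm (g 0 w) + h 0 w)"
      using fh(4)
    proof eventually_elim
      case (elim w)
      from elim[rule_format, of 0] norm_triangle_ineq4[of "g 0 w" "g 0 w - f w"] show ?case by simp
    qed
  qed (rule norm_measurable[OF fh(1)])
  with s r(1) g fh show ?thesis by (intro that)
qed

section \<open>Integration of the coefficients and attainment of the norm\<close>

text \<open>Dominated convergence: the coefficients are nonnegative and their partial sums increase
  to \<open>norm (f w)\<close>, which is itself the majorant.\<close>

lemma gen_reps_integrals_sums:
  fixes e :: "nat \<Rightarrow> 'b::banach"
  assumes e: "\<And>i. norm (e i) \<le> 1" and int: "integrable M (\<lambda>w. norm (f w))"
    and x: "\<And>i. x i \<in> borel_measurable M" "AE w in M. (\<lambda>i. x i w) \<in> gen_reps e (f w)"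
  shows "integrable M (x i)" "(\<lambda>i. \<integral>w. \<bar>x i w\<bar> \<partial>M) sums (\<integral>w. norm (f w) \<partial>M)"
proof -
  show xint: "integrable M (x i)" for i
  proof (rule Bochner_Integration.integrable_bound[OF int x(1)])
    show "AE w in M. norm (x i w) \<le> norm (norm (f w))"
      using x(2)
    proof eventually_elim
      case (elim w)
      then have "0 \<le> x i w" for i by (simp add: gen_reps_def)
      moreover have "(\<Sum>i<Suc i. x i w) \<le> norm (f w)" using elim unfolding gen_reps_def by blast
      ultimately show ?case using sum_nonneg[of "{..<i}" "\<lambda>i. x i w"] by simp
    qed
  qed
  have "(\<lambda>n. \<integral>w. (\<Sum>i<n. \<bar>x i w\<bar>) \<partial>M) \<longlonglongrightarrow> (\<integral>w. norm (f w) \<partial>M)"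
  proof (rule integral_dominated_convergence)
    show "integrable M (\<lambda>w. norm (f w))" by (rule int)
    then show "(\<lambda>w. norm (f w)) \<in> borel_measurable M" by simp
    show "(\<lambda>w. \<Sum>i<n. \<bar>x i w\<bar>) \<in> borel_measurable M" for n using x(1) by simp
    show "AE w in M. (\<lambda>n. \<Sum>i<n. \<bar>x i w\<bar>) \<longlonglongrightarrow> norm (f w)"
      using x(2)
    proof eventually_elim
      case (elim w)
      then have "0 \<le> x i w" for i by (simp add: gen_reps_def)
      then show ?case using gen_reps_sums_norm[OF elim e] by (simp add: sums_def)
    qed
    show "AE w in M. norm (\<Sum>i<n. \<bar>x i w\<bar>) \<le> norm (f w)" for n
      using x(2)
    proof eventually_elim
      case (elim w)
      then have "0 \<le> x i w" for i by (simp add: gen_reps_def)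
      moreover have "(\<Sum>i<n. x i w) \<le> norm (f w)" using elim by (simp add: gen_reps_def)
      ultimately show ?case by (simp add: sum_nonneg)
    qed
  qed
  then show "(\<lambda>i. \<integral>w. \<bar>x i w\<bar> \<partial>M) sums (\<integral>w. norm (f w) \<partial>M)"
    using xint by (simp add: sums_def)
qed

lemma CCG_attains_projective_norm:
  assumes ccg: "CCG TYPE('b::banach)"
    and u: "u \<in> carrier (projective_tensor_product (L1 M) (type_space :: 'b nspace))"
  shows "attains_projective_norm (L1 M) type_space u"
proof -
  let ?T = "L1_tensor M :: (('a \<Rightarrow> real) set, 'b) tensor nspace"
  let ?P = "projective_tensor_product (L1 M) (type_space :: 'b nspace)"
  obtain e :: "nat \<Rightarrow> 'b" where e: "\<And>i. norm (e i) = 1" and ne: "\<And>y. gen_reps e y \<noteq> {}"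
    using CCG_gen_reps[OF ccg] by metis
  then have e1: "norm (e i) \<le> 1" for i by simp
  obtain s r g and f :: "'a \<Rightarrow> 'b" and h where s: "s \<in> cauchy_seqs ?T" "u = null_rel ?T `` {s}"
    and r: "strict_mono r" and g: "\<And>k. represents M (s (r k)) (g k)"
    and f: "f \<in> borel_measurable M" "integrable M (\<lambda>w. norm (f w))"
    and h: "\<And>k. integrable M (h k)" "(\<lambda>k. \<integral>w. h k w \<partial>M) \<longlonglongrightarrow> 0"
    and gf: "AE w in M. \<forall>k. norm (g k w - f w) \<le> h k w"
    using projective_tensor_limit_function[OF u] by blast
  obtain x where x: "\<And>i. x i \<in> borel_measurable M" "AE w in M. (\<lambda>i. x i w) \<in> gen_reps e (f w)"
    by (rule gen_reps_selection[OF f e1 ne]) blast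
  note xint = gen_reps_integrals_sums(1)[OF e1 f(2) x]
  note xsums = gen_reps_integrals_sums(2)[OF e1 f(2) x]
  define I where "I = (\<integral>w. norm (f w) \<partial>M)"
  \<comment> \<open>The norm of \<open>u\<close> is the limit of the integrals of
    \<open>norm (g k w)\<close>, and these differ from \<open>I\<close> by at most the integral of
    \<open>h k\<close>.\<close>
  have norm_u: "vnorm ?P u = I"
  proof (rule LIMSEQ_unique)
    have "(\<lambda>k. vnorm ?T (s k)) \<longlonglongrightarrow> vnorm ?P u"
      unfolding s(2) projective_tensor_product_def
      by (rule seminormed_space.completion_norm_class[OF seminormed_L1_tensor s(1)])
    from LIMSEQ_subseq_LIMSEQ[OF this r]
    show "(\<lambda>k. \<integral>w. norm (g k w) \<partial>M) \<longlonglongrightarrow> vnorm ?P u"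
      by (simp add: o_def represents_norm[OF g])
    have "norm ((\<integral>w. norm (g k w) \<partial>M) - I) \<le> (\<integral>w. h k w \<partial>M)" for k
    proof -
      have gi: "integrable M (\<lambda>w. norm (g k w))" by (rule represents_integrable[OF g])
      have "norm ((\<integral>w. norm (g k w) \<partial>M) - I) = norm (\<integral>w. norm (g k w) - norm (f w) \<partial>M)"
        unfolding I_def using gi f(2) by simp
      also have "\<dots> \<le> (\<integral>w. norm (norm (g k w) - norm (f w)) \<partial>M)" by (rule integral_norm_bound)
      also have "\<dots> \<le> (\<integral>w. h k w \<partial>M)"
      proof (rule integral_mono_AE)
        show "AE w in M. norm (norm (g k w) - norm (f w)) \<le> h k w"
          using gf
        proof eventually_elim
          case (elim w)
          then show ?case using norm_triangle_ineq3[of "g k w" "f w"] by (auto intro: order_trans)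
        qed
      qed (use gi f(2) h(1) in auto)
      finally show ?thesis .
    qed
    from null_comparison[OF h(2) this] show "(\<lambda>k. \<integral>w. norm (g k w) \<partial>M) \<longlonglongrightarrow> I"
      by (simp add: LIM_zero_iff)
  qed
  define S where "S n = vsum ?T (\<lambda>i. tensor (L1 M) type_space (L1_class M (x i)) (e i)) n" for n
  have S: "represents M (S n) (\<lambda>w. \<Sum>i<n. x i w *\<^sub>R e i)" for n
    unfolding S_def by (rule represents_vsum[OF xint])
  \<comment> \<open>Integrating \<open>gen_reps_tail\<close> bounds the distance by the part of
    \<open>I\<close> that the first \<open>n\<close> coefficients have not yet used, up to an error
    \<open>h k\<close> that disappears as \<open>k\<close> grows.\<close>
  have dist_le: "vdist ?P (null_rel ?T `` {\<lambda>_. S n}) u \<le> I - (\<Sum>i<n. \<integral>w. \<bar>x i w\<bar> \<partial>M)" for n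
  proof (rule LIMSEQ_le)
    have "(\<lambda>k. vdist ?T (S n) (s k)) \<longlonglongrightarrow> vdist ?P (null_rel ?T `` {\<lambda>_. S n}) u"
      unfolding s(2) projective_tensor_product_def
      by (intro seminormed_space.completion_vdist[OF seminormed_L1_tensor]
          seminormed_space.cauchy_seqs_const[OF seminormed_L1_tensor] represents_carrier[OF S] s(1))
    from LIMSEQ_subseq_LIMSEQ[OF this r]
    show "(\<lambda>k. \<integral>w. norm ((\<Sum>i<n. x i w *\<^sub>R e i) - g k w) \<partial>M) \<longlonglongrightarrow>
        vdist ?P (null_rel ?T `` {\<lambda>_. S n}) u"
      by (simp add: o_def represents_vdist[OF S g])
    show "(\<lambda>k. I - (\<Sum>i<n. \<integral>w. \<bar>x i w\<bar> \<partial>M) + (\<integral>w. h k w \<partial>M)) \<longlonglongrightarrow>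
        I - (\<Sum>i<n. \<integral>w. \<bar>x i w\<bar> \<partial>M)"
      using tendsto_add[OF tendsto_const h(2)] by simp
    have "(\<integral>w. norm ((\<Sum>i<n. x i w *\<^sub>R e i) - g k w) \<partial>M) \<le>
        I - (\<Sum>i<n. \<integral>w. \<bar>x i w\<bar> \<partial>M) + (\<integral>w. h k w \<partial>M)" for k
    proof -
      have "(\<integral>w. norm ((\<Sum>i<n. x i w *\<^sub>R e i) - g k w) \<partial>M) \<le>
        (\<integral>w. norm (f w) - (\<Sum>i<n. \<bar>x i w\<bar>) + h k w \<partial>M)"
      proof (rule integral_mono_AE)
        show "integrable M (\<lambda>w. norm ((\<Sum>i<n. x i w *\<^sub>R e i) - g k w))"
          by (rule represents_integrable[OF represents_diff[OF S g]])
        show "integrable M (\<lambda>w. norm (f w) - (\<Sum>i<n. \<bar>x i w\<bar>) + h k w)"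
          using f(2) xint h(1) by simp
        show "AE w in M. norm ((\<Sum>i<n. x i w *\<^sub>R e i) - g k w) \<le>
            norm (f w) - (\<Sum>i<n. \<bar>x i w\<bar>) + h k w"
          using x(2) gf
        proof eventually_elim
          case (elim w)
          have "0 \<le> x i w" for i using elim(1) by (simp add: gen_reps_def)
          moreover have "norm ((\<Sum>i<n. x i w *\<^sub>R e i) - g k w) \<le>
              norm ((\<Sum>i<n. x i w *\<^sub>R e i) - f w) + norm (f w - g k w)"
            using norm_triangle_ineq[of "(\<Sum>i<n. x i w *\<^sub>R e i) - f w" "f w - g k w"] by simp
          moreover have "norm (f w - g k w) \<le> h k w"
            using elim(2) by (simp add: norm_minus_commute)
          ultimately show ?case using gen_reps_tail[OF elim(1) e1, of n] by simp
        qed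
      qed
      also have "\<dots> = I - (\<Sum>i<n. \<integral>w. \<bar>x i w\<bar> \<partial>M) + (\<integral>w. h k w \<partial>M)"
        unfolding I_def using f(2) xint h(1) by simp
      finally show ?thesis .
    qed
    then show "\<exists>N. \<forall>k\<ge>N. (\<integral>w. norm ((\<Sum>i<n. x i w *\<^sub>R e i) - g k w) \<partial>M) \<le>
        I - (\<Sum>i<n. \<integral>w. \<bar>x i w\<bar> \<partial>M) + (\<integral>w. h k w \<partial>M)" by blast
  qed
  have nP: "seminormed_space ?P"
    using normed_space_projective_tensor_product[OF seminormed_L1 seminormed_type_space]
    by (rule normed_space.axioms)
  have "(\<lambda>n. vdist ?P (null_rel ?T `` {\<lambda>_. S n}) u) \<longlonglongrightarrow> 0"
  proof (rule null_comparison)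
    have "(\<lambda>n. I - (\<Sum>i<n. \<integral>w. \<bar>x i w\<bar> \<partial>M)) \<longlonglongrightarrow> I - I"
      using xsums unfolding I_def sums_def by (intro tendsto_diff tendsto_const)
    then show "(\<lambda>n. I - (\<Sum>i<n. \<integral>w. \<bar>x i w\<bar> \<partial>M)) \<longlonglongrightarrow> 0" by simp
    fix n
    have "null_rel ?T `` {\<lambda>_. S n} \<in> carrier ?P"
      unfolding projective_tensor_product_def
      by (intro seminormed_space.completion_carrierI[OF seminormed_L1_tensor]
          seminormed_space.cauchy_seqs_const[OF seminormed_L1_tensor] represents_carrier[OF S])
    then show "norm (vdist ?P (null_rel ?T `` {\<lambda>_. S n}) u) \<le> I - (\<Sum>i<n. \<integral>w. \<bar>x i w\<bar> \<partial>M)"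
      using dist_le[of n] seminormed_space.vdist_nonneg[OF nP _ u] by simp
  qed
  then have "vsums ?P (\<lambda>i. proj_tensor (L1 M) type_space (L1_class M (x i)) (e i)) u"
    unfolding vsums_def vsum_proj_tensor[OF xint] S_def .
  moreover have "(\<lambda>i. vnorm (L1 M) (L1_class M (x i)) * vnorm type_space (e i)) sums vnorm ?P u"
    \<comment> \<open>Because \<open>norm (e i) = 1\<close>, the cost of each elementary tensor is
      exactly the integral of its coefficient.\<close>
    using xsums by (simp add: norm_u I_def L1_norm_class[OF xint] e)
  moreover have "\<forall>i. L1_class M (x i) \<in> carrier (L1 M)" using xint by (simp add: L1_carrierI)
  ultimately show ?thesis
    unfolding attains_projective_norm_def
    by (intro exI[of _ "\<lambda>i. L1_class M (x i)"] exI[of _ e]) simp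
qed

theorem theorem5p4:
  fixes M :: "'a measure"
  assumes "CCG TYPE('b::banach)"
  shows "NA_pi (L1 M) (type_space :: 'b nspace) =
    carrier (projective_tensor_product (L1 M) (type_space :: 'b nspace))"
  using CCG_attains_projective_norm[OF assms] by (auto simp: NA_pi_def)

end
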